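(* Let $G$ be a finite group. Then (i) the strong Engel graph of $G$ is equal to the Engel graph of $G$ if and only if $G$ is nilpotent; and (ii) the strong Engel graph of $G$ is equal to the nilpotency graph of $G$ if and only if $G$ is two-sided Engel tame.
   Context: For elements $x,y$ of a group, $[x,y]=x^{-1}y^{-1}xy$, $[x,{}_1y]=[x,y]$ and $[x,{}_{k+1}y]=[[x,{}_ky],y]$ for $k\ge 1$. The Engel digraph of $G$ has vertex set $G$ and, for distinct $x,y$, an arc $x\to y$ if there exists $k\geq 1$ such that $[y,{}_kx]=1$. All three graphs are simple undirected graphs with vertex set $G$: in the Engel graph, distinct $x,y$ are adjacent iff $x\to y$ or $y\to x$; in the strong Engel graph, distinct $x,y$ are adjacent iff $x\to y$ and $y\to x$; in the nilpotency graph, distinct $x,y$ are adjacent iff $\langle x,y\rangle$ is nilpotent. The group $G$ is two-sided Engel tame if for all $x,y\in G$, if $x\to y$ and $y\to x$ in the Engel digraph of $G$, then $\langle x,y\rangle$ is nilpotent. *)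

theory Defs
  imports "HOL-Algebra.Generated_Groups" "Graph_Theory.Pair_Digraph"
begin

definition commutator :: "('a, 'b) monoid_scheme \<Rightarrow> 'a \<Rightarrow> 'a \<Rightarrow> 'a" where
  "commutator G x y = inv\<^bsub>G\<^esub> x \<otimes>\<^bsub>G\<^esub> inv\<^bsub>G\<^esub> y \<otimes>\<^bsub>G\<^esub> x \<otimes>\<^bsub>G\<^esub> y"

text \<open>
  \<open>engel_commutator G x k y\<close> is the left-normed commutator \<open>[x, y, ..., y]\<close> with \<open>k\<close> entries \<open>y\<close>.
  The value \<open>x\<close> at \<open>k = 0\<close> is only the start of the recursion, so that \<open>k = 1\<close> gives \<open>[x, y]\<close>.
\<close>
primrec engel_commutator :: "('a, 'b) monoid_scheme \<Rightarrow> 'a \<Rightarrow> nat \<Rightarrow> 'a \<Rightarrow> 'a" where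
  "engel_commutator G x 0 y = x"
| "engel_commutator G x (Suc k) y = commutator G (engel_commutator G x k y) y"

text \<open>The lower central series is indexed from \<open>0\<close>: term \<open>n\<close> is the usual \<open>\<gamma>\<close> of index \<open>n + 1\<close>.\<close>
primrec lower_central_series :: "('a, 'b) monoid_scheme \<Rightarrow> nat \<Rightarrow> 'a set" where
  "lower_central_series G 0 = carrier G"
| "lower_central_series G (Suc n) =
     generate G {commutator G x y | x y. x \<in> lower_central_series G n \<and> y \<in> carrier G}"

definition nilpotent_group :: "('a, 'b) monoid_scheme \<Rightarrow> bool" where
  "nilpotent_group G \<longleftrightarrow> group G \<and> (\<exists>n. lower_central_series G n = {\<one>\<^bsub>G\<^esub>})"

abbreviation subgroup_generated_by2 :: "('a, 'b) monoid_scheme \<Rightarrow> 'a \<Rightarrow> 'a \<Rightarrow> ('a, 'b) monoid_scheme"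
  where "subgroup_generated_by2 G x y \<equiv> G\<lparr>carrier := generate G {x, y}\<rparr>"

definition engel_digraph :: "('a, 'b) monoid_scheme \<Rightarrow> 'a pair_pre_digraph" where
  "engel_digraph G = \<lparr>pverts = carrier G,
     parcs = {(x, y). x \<in> carrier G \<and> y \<in> carrier G \<and> x \<noteq> y \<and>
                      (\<exists>k\<ge>1. engel_commutator G y k x = \<one>\<^bsub>G\<^esub>)}\<rparr>"

text \<open>
  As usual in \<open>Graph_Theory\<close>, a simple undirected graph is a loop-free digraph with a symmetric
  arc relation, so equality of records is equality of vertex sets and of adjacency relations.
\<close>

definition engel_graph :: "('a, 'b) monoid_scheme \<Rightarrow> 'a pair_pre_digraph" where
  "engel_graph G = \<lparr>pverts = carrier G,
     parcs = {(x, y). x \<in> carrier G \<and> y \<in> carrier G \<and> x \<noteq> y \<and>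
                      ((x, y) \<in> parcs (engel_digraph G) \<or> (y, x) \<in> parcs (engel_digraph G))}\<rparr>"

definition strong_engel_graph :: "('a, 'b) monoid_scheme \<Rightarrow> 'a pair_pre_digraph" where
  "strong_engel_graph G = \<lparr>pverts = carrier G,
     parcs = {(x, y). x \<in> carrier G \<and> y \<in> carrier G \<and> x \<noteq> y \<and>
                      (x, y) \<in> parcs (engel_digraph G) \<and> (y, x) \<in> parcs (engel_digraph G)}\<rparr>"

definition nilpotency_graph :: "('a, 'b) monoid_scheme \<Rightarrow> 'a pair_pre_digraph" where
  "nilpotency_graph G = \<lparr>pverts = carrier G,
     parcs = {(x, y). x \<in> carrier G \<and> y \<in> carrier G \<and> x \<noteq> y \<and>
                      nilpotent_group (subgroup_generated_by2 G x y)}\<rparr>"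

definition two_sided_engel_tame :: "('a, 'b) monoid_scheme \<Rightarrow> bool" where
  "two_sided_engel_tame G \<longleftrightarrow>
     (\<forall>x\<in>carrier G. \<forall>y\<in>carrier G.
        (x, y) \<in> parcs (engel_digraph G) \<and> (y, x) \<in> parcs (engel_digraph G) \<longrightarrow>
        nilpotent_group (subgroup_generated_by2 G x y))"

lemma pair_digraphI:
  assumes "finite (pverts H)" "parcs H \<subseteq> pverts H \<times> pverts H" "\<And>x. (x, x) \<notin> parcs H"
  shows "pair_digraph H"
proof
  show "finite (parcs H)"
    using assms(1,2) by (meson finite_SigmaI finite_subset)
qed (use assms in \<open>force+\<close>)

lemma pair_graphI:
  assumes "finite (pverts H)" "parcs H \<subseteq> pverts H \<times> pverts H" "\<And>x. (x, x) \<notin> parcs H"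
    and "sym (parcs H)"
  shows "pair_graph H"
proof -
  interpret pair_digraph H using assms(1-3) by (rule pair_digraphI)
  show ?thesis by unfold_locales (simp add: symmetric_def assms(4))
qed

lemma pair_digraph_engel_digraph:
  assumes "finite (carrier G)" shows "pair_digraph (engel_digraph G)"
  by (rule pair_digraphI) (use assms in \<open>auto simp: engel_digraph_def\<close>)

lemma pair_graph_engel_graph:
  assumes "finite (carrier G)" shows "pair_graph (engel_graph G)"
  by (rule pair_graphI) (use assms in \<open>auto simp: engel_graph_def intro!: symI\<close>)

lemma pair_graph_strong_engel_graph:
  assumes "finite (carrier G)" shows "pair_graph (strong_engel_graph G)"
  by (rule pair_graphI) (use assms in \<open>auto simp: strong_engel_graph_def intro!: symI\<close>)

lemma pair_graph_nilpotency_graph: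
  assumes "finite (carrier G)" shows "pair_graph (nilpotency_graph G)"
  by (rule pair_graphI)
    (use assms in \<open>auto simp: nilpotency_graph_def insert_commute intro!: symI\<close>)

end

theory Submission
  imports Defs "HOL-Algebra.Sylow" "HOL-Algebra.Group_Action" "HOL-Algebra.Multiplicative_Group"
begin

text \<open>
  The strong Engel graph equals the Engel graph iff the relation \<open>\<exists>k. [y, x, ..., x] = 1\<close>, with \<open>k\<close>
  entries \<open>x\<close>, is symmetric, and the point is that a finite group \<open>G\<close> with this property is
  nilpotent. The property passes to subgroups, so all proper subgroups of a minimal counterexample
  are nilpotent. Let \<open>Z\<close> be its hypercentre. Elements of a nilpotent normal subgroup \<open>N\<close> are left
  Engel, hence by symmetry right Engel, and this forces \<open>N \<subseteq> Z\<close>: otherwise, for a suitable prime \<open>p\<close>,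
  the elements of order \<open>p\<close> in the centre of \<open>N Z / Z\<close> are centralized by all elements of order
  prime to \<open>p\<close>, while a Sylow \<open>p\<close>-subgroup has a nontrivial fixed point among them, which would be
  central modulo \<open>Z\<close>. Therefore maximal subgroups are self-normalizing and contain \<open>Z\<close>, and a
  largest intersection of two of them, being normal by the growth of normalizers in nilpotent
  groups, is \<open>Z\<close>. So the conjugates of a maximal subgroup meet pairwise in \<open>Z\<close> and their union
  minus \<open>Z\<close> contains at least half as many elements as \<open>G\<close>, without exhausting \<open>G - Z\<close>; the
  conjugates of a further maximal subgroup then do not fit into \<open>G - Z\<close>.
\<close>

section \<open>Commutators and central series\<close>

context group
begin

lemma inv_mult_cancel: "x \<in> carrier G \<Longrightarrow> y \<in> carrier G \<Longrightarrow> inv x \<otimes> (x \<otimes> y) = y"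
  by (simp flip: m_assoc)

lemma mult_inv_cancel: "x \<in> carrier G \<Longrightarrow> y \<in> carrier G \<Longrightarrow> x \<otimes> (inv x \<otimes> y) = y"
  by (simp flip: m_assoc)

lemmas group_word_simps = m_assoc inv_mult_group inv_mult_cancel mult_inv_cancel

lemma commutator_closed [simp]:
  "x \<in> carrier G \<Longrightarrow> y \<in> carrier G \<Longrightarrow> commutator G x y \<in> carrier G"
  by (simp add: commutator_def)

lemma engel_commutator_closed [simp]:
  "x \<in> carrier G \<Longrightarrow> y \<in> carrier G \<Longrightarrow> engel_commutator G x k y \<in> carrier G"
  by (induction k) auto

lemma commutator_one_left [simp]: "y \<in> carrier G \<Longrightarrow> commutator G \<one> y = \<one>"
  by (simp add: commutator_def)

lemma commutator_one_right [simp]: "x \<in> carrier G \<Longrightarrow> commutator G x \<one> = \<one>"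
  by (simp add: commutator_def)

lemma commutator_self [simp]: "x \<in> carrier G \<Longrightarrow> commutator G x x = \<one>"
  by (simp add: commutator_def group_word_simps)

lemma commutator_eq_one_iff:
  assumes "x \<in> carrier G" "y \<in> carrier G"
  shows "commutator G x y = \<one> \<longleftrightarrow> x \<otimes> y = y \<otimes> x"
proof -
  have "commutator G x y = inv (y \<otimes> x) \<otimes> (x \<otimes> y)"
    using assms by (simp add: commutator_def group_word_simps)
  then show ?thesis
    using assms by (metis inv_solve_left m_closed one_closed r_one)
qed

lemma commutator_inv:
  assumes "x \<in> carrier G" "y \<in> carrier G"
  shows "inv (commutator G x y) = commutator G y x"
  using assms by (simp add: commutator_def group_word_simps)

lemma commutator_mult_left:
  assumes "x \<in> carrier G" "y \<in> carrier G" "g \<in> carrier G"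
  shows "commutator G (x \<otimes> y) g = inv y \<otimes> commutator G x g \<otimes> y \<otimes> commutator G y g"
  using assms by (simp add: commutator_def group_word_simps)

lemma commutator_mult_right:
  assumes "x \<in> carrier G" "g \<in> carrier G" "h \<in> carrier G"
  shows "commutator G x (g \<otimes> h) = commutator G x h \<otimes> (inv h \<otimes> commutator G x g \<otimes> h)"
  using assms by (simp add: commutator_def group_word_simps)

lemma commutator_inv_left:
  assumes "x \<in> carrier G" "g \<in> carrier G"
  shows "commutator G (inv x) g = x \<otimes> inv (commutator G x g) \<otimes> inv x"
  using assms by (simp add: commutator_def group_word_simps)

lemma commutator_inv_right:
  assumes "x \<in> carrier G" "g \<in> carrier G"
  shows "commutator G x (inv g) = g \<otimes> inv (commutator G x g) \<otimes> inv g"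
  using assms by (simp add: commutator_def group_word_simps)

lemma commutator_conjugate:
  assumes "x \<in> carrier G" "w \<in> carrier G" "g \<in> carrier G"
  shows "commutator G (w \<otimes> x \<otimes> inv w) g = w \<otimes> commutator G x (inv w \<otimes> g \<otimes> w) \<otimes> inv w"
  using assms by (simp add: commutator_def group_word_simps)

lemma subgroup_commutator_closed:
  assumes "subgroup H G" "x \<in> H" "y \<in> H"
  shows "commutator G x y \<in> H"
  using assms unfolding commutator_def
  by (simp add: subgroup.m_closed subgroup.m_inv_closed)

text \<open>Follows from writing \<open>[x, y]\<close> as the inverse of the conjugate
  \<open>inv x \<otimes> y \<otimes> x\<close> times \<open>y\<close>. It turns commutator
  conditions into normalizing conditions.\<close>

lemma subgroup_commutator_closed_iff:
  assumes "subgroup H G" "x \<in> carrier G" "y \<in> H"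
  shows "commutator G x y \<in> H \<longleftrightarrow> inv x \<otimes> y \<otimes> x \<in> H"
proof -
  have y: "y \<in> carrier G" using subgroup.mem_carrier[OF assms(1,3)] .
  have *: "commutator G x y = inv (inv x \<otimes> y \<otimes> x) \<otimes> y"
    using assms(2) y by (simp add: commutator_def group_word_simps)
  have "inv (inv x \<otimes> y \<otimes> x) = commutator G x y \<otimes> inv y"
    using assms(2) y by (simp add: commutator_def group_word_simps)
  then have **: "inv x \<otimes> y \<otimes> x = inv (commutator G x y \<otimes> inv y)"
    using assms(2) y inv_inv[of "inv x \<otimes> y \<otimes> x"] by simp
  show ?thesis
  proof
    assume "commutator G x y \<in> H"
    then show "inv x \<otimes> y \<otimes> x \<in> H"
      unfolding ** using subgroup.m_closed subgroup.m_inv_closed assms(1,3) by metis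
  next
    assume "inv x \<otimes> y \<otimes> x \<in> H"
    then show "commutator G x y \<in> H"
      unfolding * using subgroup.m_closed subgroup.m_inv_closed assms(1,3) by metis
  qed
qed

lemma commutator_consistent:
  assumes "subgroup H G" "x \<in> H" "y \<in> H"
  shows "commutator (G\<lparr>carrier := H\<rparr>) x y = commutator G x y"
  using assms by (simp add: commutator_def)

lemma engel_commutator_consistent:
  assumes "subgroup H G" "x \<in> H" "y \<in> H"
  shows "engel_commutator (G\<lparr>carrier := H\<rparr>) x k y = engel_commutator G x k y"
    and "engel_commutator G x k y \<in> H"
proof (induction k)
  case (Suc k)
  { case 1 show ?case using Suc commutator_consistent assms by simp }
  { case 2 show ?case using Suc subgroup_commutator_closed assms by simp }
qed (use assms in auto)

lemma engel_commutator_add: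
  "engel_commutator G x (j + k) y = engel_commutator G (engel_commutator G x j y) k y"
  by (induction k) auto

end

lemma (in group_hom) hom_commutator:
  assumes "x \<in> carrier G" "y \<in> carrier G"
  shows "h (commutator G x y) = commutator H (h x) (h y)"
  using assms by (simp add: commutator_def)

lemma (in group_hom) hom_engel_commutator:
  assumes "x \<in> carrier G" "y \<in> carrier G"
  shows "h (engel_commutator G x k y) = engel_commutator H (h x) k (h y)"
  using assms by (induction k) (simp_all add: hom_commutator)

text \<open>For normal \<open>N\<close> this is the preimage in \<open>G\<close> of the centre of
  \<open>G Mod N\<close>.\<close>

definition central_modulo :: "('a, 'b) monoid_scheme \<Rightarrow> 'a set \<Rightarrow> 'a set" where
  "central_modulo G N = {x \<in> carrier G. \<forall>g\<in>carrier G. commutator G x g \<in> N}"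

primrec upper_central_series :: "('a, 'b) monoid_scheme \<Rightarrow> nat \<Rightarrow> 'a set" where
  "upper_central_series G 0 = {\<one>\<^bsub>G\<^esub>}"
| "upper_central_series G (Suc n) = central_modulo G (upper_central_series G n)"

context group
begin

lemma subset_central_modulo:
  assumes "N \<lhd> G" shows "N \<subseteq> central_modulo G N"
proof
  interpret N: normal N G by fact
  fix x assume x: "x \<in> N"
  have "commutator G x g \<in> N" if "g \<in> carrier G" for g
  proof -
    have "commutator G x g = inv x \<otimes> (inv g \<otimes> x \<otimes> g)"
      using x that by (simp add: commutator_def m_assoc)
    then show ?thesis using x that by (simp add: N.inv_op_closed1)
  qed
  then show "x \<in> central_modulo G N" using x by (simp add: central_modulo_def)
qed

lemma normal_central_modulo:
  assumes "N \<lhd> G" shows "central_modulo G N \<lhd> G"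
proof -
  interpret N: normal N G by fact
  have "subgroup (central_modulo G N) G"
  proof (rule subgroupI)
    show "central_modulo G N \<noteq> {}"
      using subset_central_modulo[OF assms] N.one_closed by blast
  next
    fix x assume "x \<in> central_modulo G N"
    then show "inv x \<in> central_modulo G N"
      by (simp add: central_modulo_def commutator_inv_left N.inv_op_closed2)
  next
    fix x y assume "x \<in> central_modulo G N" "y \<in> central_modulo G N"
    then show "x \<otimes> y \<in> central_modulo G N"
      by (simp add: central_modulo_def commutator_mult_left N.inv_op_closed1)
  qed (simp add: central_modulo_def)
  then show ?thesis
    by (simp add: normal_inv_iff central_modulo_def commutator_conjugate N.inv_op_closed2)
qed

text \<open>The set is the preimage of the centralizer of the coset of \<open>x\<close> in
  \<open>G Mod N\<close>. For trivial \<open>N\<close> it is the ordinary centralizer.\<close>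

lemma subgroup_centralizer_modulo:
  assumes "N \<lhd> G" "x \<in> carrier G"
  shows "subgroup {g \<in> carrier G. commutator G x g \<in> N} G"
proof -
  interpret N: normal N G by fact
  show ?thesis
  proof (rule subgroupI)
    have "\<one> \<in> {g \<in> carrier G. commutator G x g \<in> N}" using assms by simp
    then show "{g \<in> carrier G. commutator G x g \<in> N} \<noteq> {}" by blast
  next
    fix g assume "g \<in> {g \<in> carrier G. commutator G x g \<in> N}"
    then show "inv g \<in> {g \<in> carrier G. commutator G x g \<in> N}"
      using assms(2) by (simp add: commutator_inv_right N.inv_op_closed2)
  next
    fix g h
    assume "g \<in> {g \<in> carrier G. commutator G x g \<in> N}" "h \<in> {g \<in> carrier G. commutator G x g \<in> N}"
    then show "g \<otimes> h \<in> {g \<in> carrier G. commutator G x g \<in> N}"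
      using assms(2) by (simp add: commutator_mult_right N.inv_op_closed1)
  qed simp
qed

lemma normal_upper_central_series: "upper_central_series G n \<lhd> G"
  by (induction n) (auto simp: normal_central_modulo one_is_normal)

lemma upper_central_series_mono: "upper_central_series G n \<subseteq> upper_central_series G (n + k)"
  by (induction k) (use subset_central_modulo normal_upper_central_series in auto)

text \<open>If every step were strict, term \<open>n\<close> would have at least \<open>n\<close>
  elements for every \<open>n\<close>. The stable term is the hypercentre.\<close>

lemma upper_central_series_stable:
  assumes "finite (carrier G)"
  obtains n where "central_modulo G (upper_central_series G n) = upper_central_series G n"
proof (rule ccontr)
  let ?Z = "upper_central_series G"
  assume "\<not> thesis"
  then have "?Z (Suc n) \<noteq> ?Z n" for n using that by auto
  then have "?Z n \<subset> ?Z (Suc n)" for n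
    using upper_central_series_mono[of n 1] by auto
  moreover have fin: "finite (?Z n)" for n
    using assms normal_imp_subgroup[OF normal_upper_central_series] subgroup.subset finite_subset
    by metis
  ultimately have "card (?Z n) < card (?Z (Suc n))" for n
    by (meson psubset_card_mono)
  then have "n \<le> card (?Z n)" for n
    by (induction n) (simp, meson Suc_leI le_less_trans)
  moreover have "card (?Z n) \<le> card (carrier G)" for n
    using assms normal_imp_subgroup[OF normal_upper_central_series] subgroup.subset card_mono
    by metis
  ultimately show False by (meson not_less_eq_eq order.trans)
qed

section \<open>The lower central series and nilpotency\<close>

lemma lower_central_series_subset_carrier: "lower_central_series G n \<subseteq> carrier G"
proof (induction n)
  case (Suc n)
  then show ?case by (auto intro!: generate_incl)
qed simp

lemma commutator_in_lower_central_series: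
  assumes "x \<in> lower_central_series G n" "y \<in> carrier G"
  shows "commutator G x y \<in> lower_central_series G (Suc n)"
  using assms by (auto intro!: generate.incl)

lemma one_in_lower_central_series: "\<one> \<in> lower_central_series G n"
  by (cases n) (auto intro: generate.one)

lemma engel_commutator_in_lower_central_series:
  assumes "x \<in> carrier G" "y \<in> carrier G"
  shows "engel_commutator G x k y \<in> lower_central_series G k"
proof (induction k)
  case (Suc k)
  then show ?case using commutator_in_lower_central_series[of _ k y] assms by simp
qed (simp add: assms)

text \<open>Each further commutator moves one term down the lower central series, so its length
  serves all pairs at once. The exponent \<open>Suc c\<close> is positive, as the arcs of the Engel
  digraph demand.\<close>

lemma nilpotent_imp_engel:
  assumes "nilpotent_group G"
  obtains c where "\<And>x y. x \<in> carrier G \<Longrightarrow> y \<in> carrier G \<Longrightarrow> engel_commutator G x (Suc c) y = \<one>"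
proof -
  obtain c where c: "lower_central_series G c = {\<one>}"
    using assms by (auto simp: nilpotent_group_def)
  have "engel_commutator G x c y = \<one>" if "x \<in> carrier G" "y \<in> carrier G" for x y
    using engel_commutator_in_lower_central_series[OF that, of c] c by simp
  then show thesis using that[of c] by simp
qed

text \<open>The witness is taken from the last term of the lower central series that is not contained in
  the set; for a proper subgroup of a nilpotent group this is the growth of normalizers.\<close>
lemma nilpotent_obtains_central_modulo:
  assumes "nilpotent_group G" "\<one> \<in> Z" "\<not> carrier G \<subseteq> Z"
  obtains y where "y \<in> carrier G" "y \<notin> Z" "\<And>g. g \<in> carrier G \<Longrightarrow> commutator G y g \<in> Z"
proof -
  let ?P = "\<lambda>n. lower_central_series G n \<subseteq> Z"
  obtain c where "lower_central_series G c = {\<one>}"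
    using assms by (auto simp: nilpotent_group_def)
  then have "?P c" using assms(2) by simp
  moreover have "\<not> ?P 0" using assms(3) by simp
  ultimately obtain n where "\<not> ?P n" "?P (Suc n)"
    using nat_induct[of "\<lambda>n. \<not> ?P n"] by blast
  then obtain y where "y \<in> lower_central_series G n" "y \<notin> Z" by blast
  then show thesis
    using that[of y] commutator_in_lower_central_series[of y n] \<open>?P (Suc n)\<close>
      lower_central_series_subset_carrier by blast
qed

text \<open>By induction, term \<open>i\<close> of the lower series lies in term
  \<open>c - i\<close> of the upper one, so it is trivial at \<open>i = c\<close>.\<close>

lemma nilpotent_if_upper_central_series:
  assumes "upper_central_series G c = carrier G"
  shows "nilpotent_group G"
proof -
  have "i \<le> c \<Longrightarrow> lower_central_series G i \<subseteq> upper_central_series G (c - i)" for i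
  proof (induction i)
    case (Suc i)
    have "c - i = Suc (c - Suc i)" using Suc.prems by simp
    then have "lower_central_series G i \<subseteq> central_modulo G (upper_central_series G (c - Suc i))"
      using Suc by simp
    then have "{commutator G x y |x y. x \<in> lower_central_series G i \<and> y \<in> carrier G}
        \<subseteq> upper_central_series G (c - Suc i)"
      by (auto simp: central_modulo_def)
    then show ?case
      using generate_subgroup_incl normal_imp_subgroup[OF normal_upper_central_series] by simp
  qed (simp add: assms)
  from this[of c] have "lower_central_series G c = {\<one>}"
    using one_in_lower_central_series by auto
  then show ?thesis unfolding nilpotent_group_def using group_axioms by blast
qed

end

section \<open>Fixed points of \<open>p\<close>-groups\<close>

text \<open>Orbit lengths are powers of \<open>p\<close>, so the orbits of moved points have length
  divisible by \<open>p\<close>. Were \<open>x\<close> the only fixed point, \<open>card E\<close>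
  would be 1 modulo \<open>p\<close>.\<close>

lemma (in group_action) prime_power_order_fixed_point:
  assumes "prime (p :: nat)" "order G = p ^ a" "finite E" "p dvd card E"
    and x: "x \<in> E" "\<And>g. g \<in> carrier G \<Longrightarrow> \<phi> g x = x"
  shows "\<exists>y\<in>E. y \<noteq> x \<and> (\<forall>g\<in>carrier G. \<phi> g y = y)"
proof (rule ccontr)
  assume contr: "\<not> ?thesis"
  interpret G: group G using group_hom group_hom.axioms(1) by blast
  have orb_x: "orbit G \<phi> x = {x}"
    unfolding orbit_def using x G.one_closed by (auto intro!: exI[of _ \<open>\<one>\<close>])
  have dvd: "p dvd card (orbit G \<phi> y)" if y: "y \<in> E" "orbit G \<phi> y \<noteq> {x}" for y
  proof -
    have "y \<noteq> x" using y orb_x by blast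
    then obtain g where g: "g \<in> carrier G" "\<phi> g y \<noteq> y"
      using contr y(1) by blast
    then have "\<phi> g y \<in> orbit G \<phi> y" "y \<in> orbit G \<phi> y"
      using orbit_refl[OF y(1)] by (auto simp: orbit_def)
    then have "card (orbit G \<phi> y) \<noteq> 1" using g by (auto simp: card_1_singleton_iff)
    moreover have "card (orbit G \<phi> y) dvd p ^ a"
      using orbit_stabilizer_theorem[OF y(1)] assms(2) by (metis dvd_triv_left)
    ultimately show ?thesis
      using assms(1) by (metis divides_primepow_nat dvd_power gr0I power_0)
  qed
  have fin: "finite (orbits G E \<phi>)"
    using assms(3) orbits_coverture by (metis finite_UnionD)
  have "{x} \<in> orbits G E \<phi>" using x(1) orb_x unfolding orbits_def by blast
  moreover have "card E = (\<Sum>X\<in>orbits G E \<phi>. card X)"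
    using disjoint_sum[OF assms(3), of "\<lambda>_. 1::nat"] by simp
  ultimately have "card E = 1 + (\<Sum>X\<in>orbits G E \<phi> - {{x}}. card X)"
    using fin by (simp add: sum.remove)
  moreover have "p dvd (\<Sum>X\<in>orbits G E \<phi> - {{x}}. card X)"
    using dvd by (intro dvd_sum) (auto simp: orbits_def)
  ultimately have "p dvd 1" using assms(4) by (metis dvd_add_left_iff)
  then show False using assms(1) by simp
qed

context group
begin

text \<open>The restricted lambda supplies the extensionality that \<open>Bij V\<close> demands.
  Conjugation by \<open>inv g\<close> also preserves \<open>V\<close> and inverts conjugation by
  \<open>g\<close>.\<close>

lemma subgroup_conjugation_action:
  assumes P: "subgroup P G" and V: "V \<subseteq> carrier G"
    and conj: "\<And>g v. g \<in> P \<Longrightarrow> v \<in> V \<Longrightarrow> g \<otimes> v \<otimes> inv g \<in> V"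
  shows "group_action (G\<lparr>carrier := P\<rparr>) V (\<lambda>g. \<lambda>v\<in>V. g \<otimes> v \<otimes> inv g)"
proof -
  let ?\<phi> = "\<lambda>g. \<lambda>v\<in>V. g \<otimes> v \<otimes> inv g"
  have PG: "g \<in> carrier G" if "g \<in> P" for g using subgroup.mem_carrier[OF P that] .
  have VG: "v \<in> carrier G" if "v \<in> V" for v using V that by blast
  have Bij: "?\<phi> g \<in> Bij V" if g: "g \<in> P" for g
  proof -
    have "bij_betw (?\<phi> g) V V"
    proof (rule bij_betw_byWitness[where f' = "\<lambda>v. inv g \<otimes> v \<otimes> g"])
      have "inv g \<otimes> v \<otimes> g \<in> V" if "v \<in> V" for v
        using conj[OF subgroup.m_inv_closed[OF P g] that] PG[OF g] by simp
      then show "(\<lambda>v. inv g \<otimes> v \<otimes> g) ` V \<subseteq> V"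
        and "\<forall>v\<in>V. ?\<phi> g (inv g \<otimes> v \<otimes> g) = v"
        using PG[OF g] VG by (auto simp: group_word_simps)
    qed (use PG[OF g] VG conj[OF g] in \<open>auto simp: group_word_simps\<close>)
    then show ?thesis by (simp add: Bij_def)
  qed
  have "?\<phi> (g \<otimes> h) = compose V (?\<phi> g) (?\<phi> h)" if "g \<in> P" "h \<in> P" for g h
    using PG VG that conj by (auto simp: compose_def group_word_simps fun_eq_iff)
  then have "?\<phi> \<in> hom (G\<lparr>carrier := P\<rparr>) (BijGroup V)"
    using Bij by (auto simp: hom_def BijGroup_def)
  then show ?thesis
    unfolding group_action_def group_hom_def group_hom_axioms_def
    using group_BijGroup subgroup_imp_group[OF P] by blast
qed

section \<open>Sylow subgroups and elements of coprime order\<close>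

lemma card_subgroup_dvd_card_subgroup:
  assumes "subgroup H G" "subgroup K G" "H \<subseteq> K"
  shows "card H dvd card K"
proof -
  have "card (rcosets\<^bsub>G\<lparr>carrier := K\<rparr>\<^esub> H) * card H = card K"
    using group.lagrange[OF subgroup_imp_group[OF assms(2)] subgroup_incl[OF assms]]
    by (simp add: order_def)
  then show ?thesis by (metis dvd_triv_right)
qed

text \<open>A prime \<open>q\<close> that does not divide the order is allowed; the subgroup is then
  trivial.\<close>

lemma obtains_sylow_subgroup:
  assumes "finite (carrier G)" "prime (q :: nat)"
  obtains P where "subgroup P G" "card P = q ^ multiplicity q (order G)"
proof -
  have "q ^ multiplicity q (order G) dvd order G" by (rule multiplicity_dvd)
  then obtain m where "order G = q ^ multiplicity q (order G) * m" by blast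
  then show thesis using sylow_thm[OF assms(2) group_axioms _ assms(1)] that by blast
qed

text \<open>By Lagrange, the full power of each prime in \<open>order G\<close> divides
  \<open>card C\<close>, hence so does \<open>order G\<close>.\<close>

lemma subgroup_eq_carrier_if_sylow_subgroups:
  assumes "finite (carrier G)" "subgroup C G"
    and "\<And>q. prime (q :: nat) \<Longrightarrow>
      \<exists>P\<subseteq>C. subgroup P G \<and> card P = q ^ multiplicity q (order G)"
  shows "C = carrier G"
proof -
  have C: "C \<subseteq> carrier G" using assms(2) subgroup.subset by blast
  then have "finite C" using assms(1) finite_subset by blast
  then have "card C \<noteq> 0" using subgroup.one_closed[OF assms(2)] by auto
  have "order G dvd card C"
  proof (rule multiplicity_le_imp_dvd)
    show "order G \<noteq> 0" using order_gt_0_iff_finite assms(1) by simp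
    fix q :: nat assume q: "prime q"
    then obtain P where "P \<subseteq> C" "subgroup P G" "card P = q ^ multiplicity q (order G)"
      using assms(3) by blast
    then have "q ^ multiplicity q (order G) dvd card C"
      using card_subgroup_dvd_card_subgroup[of P C] assms(2) by simp
    then show "multiplicity q (order G) \<le> multiplicity q (card C)"
      using \<open>card C \<noteq> 0\<close> q by (intro multiplicity_geI) auto
  qed
  then have "card (carrier G) \<le> card C"
    using \<open>card C \<noteq> 0\<close> by (simp add: dvd_imp_le order_def)
  then show ?thesis using C assms(1) card_seteq by blast
qed

lemma subgroup_nat_pow_closed:
  assumes "subgroup H G" "x \<in> H"
  shows "x [^] (n::nat) \<in> H"
  using assms by (induction n) (simp_all add: subgroup.one_closed subgroup.m_closed)

lemma conjugate_nat_pow: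
  assumes "x \<in> carrier G" "g \<in> carrier G"
  shows "(g \<otimes> x \<otimes> inv g) [^] (n::nat) = g \<otimes> x [^] n \<otimes> inv g"
  using assms by (induction n) (simp_all add: group_word_simps)

lemma pow_coprime_eq_one:
  assumes "x \<in> carrier G" "x [^] (m::nat) = \<one>" "x [^] (n::nat) = \<one>" "coprime m n"
  shows "x = \<one>"
  using assms by (metis coprime_common_divisor_nat ord_eq_1 pow_eq_id)

text \<open>Conjugating \<open>x\<close> by the \<open>n\<close>-th power of \<open>h\<close> multiplies it by the \<open>n\<close>-th power of
  \<open>[x, h]\<close>.\<close>
lemma commutator_eq_one_if_coprime:
  assumes x: "x \<in> carrier G" and h: "h \<in> carrier G"
    and "commutator G (commutator G x h) h = \<one>"
    and "h [^] (n::nat) = \<one>" "commutator G x h [^] (m::nat) = \<one>" "coprime m n"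
  shows "commutator G x h = \<one>"
proof -
  let ?c = "commutator G x h"
  have c: "?c \<in> carrier G" "?c \<otimes> h = h \<otimes> ?c"
    using assms commutator_eq_one_iff by auto
  have "x \<otimes> h [^] k = h [^] k \<otimes> x \<otimes> ?c [^] k" for k :: nat
  proof (induction k)
    case (Suc k)
    have ck: "?c [^] k \<otimes> h = h \<otimes> ?c [^] k" using c h group_commutes_pow by auto
    have "x \<otimes> h [^] Suc k = (h [^] k \<otimes> x \<otimes> ?c [^] k) \<otimes> h"
      using x h c Suc by (simp add: m_assoc[symmetric])
    also have "\<dots> = h [^] k \<otimes> (x \<otimes> h) \<otimes> ?c [^] k"
      using x h c ck by (simp add: m_assoc)
    also have "x \<otimes> h = h \<otimes> x \<otimes> ?c"
      using x h by (simp add: commutator_def group_word_simps)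
    finally have "x \<otimes> h [^] Suc k = h [^] k \<otimes> h \<otimes> x \<otimes> (?c \<otimes> ?c [^] k)"
      using x h c by (simp add: m_assoc)
    then show ?case using c nat_pow_Suc2[of ?c k] by simp
  qed (use x in simp)
  from this[of n] have "?c [^] n = \<one>" using assms x c by simp
  then show ?thesis using pow_coprime_eq_one c assms by blast
qed

lemma inv_commute:
  assumes "x \<in> carrier G" "y \<in> carrier G" "x \<otimes> y = y \<otimes> x"
  shows "inv x \<otimes> y = y \<otimes> inv x"
  using assms commutator_eq_one_iff[of x y] commutator_eq_one_iff[of "inv x" y]
  by (simp add: commutator_inv_left)

lemma mult_commute:
  assumes "x \<in> carrier G" "y \<in> carrier G" "z \<in> carrier G"
    and "x \<otimes> z = z \<otimes> x" "y \<otimes> z = z \<otimes> y"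
  shows "x \<otimes> y \<otimes> z = z \<otimes> (x \<otimes> y)"
  using assms commutator_eq_one_iff[of x z] commutator_eq_one_iff[of y z]
    commutator_eq_one_iff[of "x \<otimes> y" z]
  by (simp add: commutator_mult_left)

text \<open>The centre of \<open>N\<close> is abelian, so taking \<open>p\<close>-th powers is
  multiplicative there. Conjugation by \<open>G\<close> permutes \<open>N\<close> and therefore
  preserves both conditions.\<close>

lemma normal_centre_torsion:
  assumes "N \<lhd> G"
  shows "{v \<in> N. (\<forall>n\<in>N. v \<otimes> n = n \<otimes> v) \<and> v [^] (p::nat) = \<one>} \<lhd> G" (is "?V \<lhd> G")
proof -
  interpret N: normal N G by fact
  have "subgroup ?V G"
  proof (rule subgroupI)
    show "?V \<subseteq> carrier G" using N.subset by blast
    have "\<one> \<in> ?V" using N.mem_carrier by simp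
    then show "?V \<noteq> {}" by blast
  next
    fix v assume v: "v \<in> ?V"
    then have "inv v \<otimes> n = n \<otimes> inv v" if "n \<in> N" for n
      using that N.mem_carrier inv_commute[of v n] by simp
    then show "inv v \<in> ?V" using v N.mem_carrier by (simp add: nat_pow_inv)
  next
    fix v w assume vw: "v \<in> ?V" "w \<in> ?V"
    have "v \<otimes> w \<otimes> n = n \<otimes> (v \<otimes> w)" if "n \<in> N" for n
    proof (rule mult_commute)
      show "v \<otimes> n = n \<otimes> v" "w \<otimes> n = n \<otimes> w" using vw that by blast+
    qed (use vw that N.mem_carrier in auto)
    moreover have "(v \<otimes> w) [^] p = \<one>"
    proof -
      have "v \<otimes> w = w \<otimes> v" "v \<in> carrier G" "w \<in> carrier G" "v [^] p = \<one>" "w [^] p = \<one>"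
        using vw N.mem_carrier by blast+
      then show ?thesis using pow_mult_distrib[of v w p] by simp
    qed
    ultimately show "v \<otimes> w \<in> ?V" using vw N.m_closed by blast
  qed
  moreover have "g \<otimes> v \<otimes> inv g \<in> ?V" if g: "g \<in> carrier G" and v: "v \<in> ?V" for g v
  proof -
    have vG: "v \<in> carrier G" using v N.mem_carrier by blast
    have "g \<otimes> v \<otimes> inv g \<otimes> n = n \<otimes> (g \<otimes> v \<otimes> inv g)" if n: "n \<in> N" for n
    proof -
      have nG: "n \<in> carrier G" using n N.mem_carrier by blast
      have "v \<otimes> (inv g \<otimes> n \<otimes> g) = (inv g \<otimes> n \<otimes> g) \<otimes> v"
        using v N.inv_op_closed1[OF g n] by blast
      then have "g \<otimes> (v \<otimes> (inv g \<otimes> n \<otimes> g)) \<otimes> inv g = g \<otimes> ((inv g \<otimes> n \<otimes> g) \<otimes> v) \<otimes> inv g"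
        by simp
      then show ?thesis using g vG nG by (simp add: group_word_simps)
    qed
    then show ?thesis
      using v g vG N.inv_op_closed2 by (simp add: conjugate_nat_pow)
  qed
  ultimately show ?thesis by (simp add: normal_inv_iff)
qed

text \<open>For a prime \<open>p\<close>, the elements of order dividing \<open>p\<close> in the centre of \<open>N\<close> form a normal
  subgroup \<open>V\<close>. The Engel condition makes the elements of order prime to \<open>p\<close> act trivially on
  \<open>V\<close>, and a Sylow \<open>p\<close>-subgroup has a nontrivial fixed point on \<open>V\<close>.\<close>
lemma right_engel_normal_ex_central:
  assumes fin: "finite (carrier G)" and "N \<lhd> G"
    and b: "b \<in> N" "b \<noteq> \<one>" "\<And>n. n \<in> N \<Longrightarrow> b \<otimes> n = n \<otimes> b"
    and engel: "\<And>n g. n \<in> N \<Longrightarrow> g \<in> carrier G \<Longrightarrow> \<exists>k. engel_commutator G n k g = \<one>"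
  shows "\<exists>y\<in>N. y \<noteq> \<one> \<and> (\<forall>g\<in>carrier G. y \<otimes> g = g \<otimes> y)"
proof -
  interpret N: normal N G by fact
  have bG: "b \<in> carrier G" using b N.mem_carrier by blast
  then have "ord b \<noteq> 1" using b ord_eq_1 by blast
  then obtain p where p: "prime p" "p dvd ord b" using prime_factor_nat by blast
  define V where "V = {v \<in> N. (\<forall>n\<in>N. v \<otimes> n = n \<otimes> v) \<and> v [^] p = \<one>}"
  interpret V: normal V G
    unfolding V_def by (rule normal_centre_torsion) fact
  \<comment> \<open>A power of \<open>b\<close> of order \<open>p\<close>, showing that
    \<open>V\<close> is nontrivial.\<close>
  define v where "v = b [^] (ord b div p)"
  have pos: "ord b > 0" using ord_ge_1[OF fin bG] by simp
  have "v \<noteq> \<one>"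
  proof
    assume "v = \<one>"
    then have "ord b dvd ord b div p" unfolding v_def using bG pow_eq_id by blast
    moreover have "0 < ord b div p" "ord b div p < ord b"
      using p pos prime_gt_1_nat[OF p(1)]
      by (auto simp: dvd_imp_le div_greater_zero_iff intro!: div_less_dividend)
    ultimately show False using dvd_imp_le by fastforce
  qed
  have "v [^] p = \<one>"
    unfolding v_def using bG p by (simp add: nat_pow_pow)
  moreover have "v \<in> N"
    unfolding v_def using b(1) by (rule subgroup_nat_pow_closed[OF N.subgroup_axioms])
  moreover have "v \<otimes> n = n \<otimes> v" if "n \<in> N" for n
    unfolding v_def using b that bG N.mem_carrier group_commutes_pow by blast
  ultimately have "v \<in> V" unfolding V_def by blast
  have finV: "finite V" using fin V.subset finite_subset by blast
  have "v [^] card V = \<one>"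
    using group.pow_order_eq_1[OF subgroup_imp_group[OF V.subgroup_axioms], of v] \<open>v \<in> V\<close>
    by (simp add: order_def nat_pow_consistent[symmetric])
  \<comment> \<open>Both \<open>p\<close> and \<open>card V\<close> are exponents of
    \<open>v\<close>; if they were coprime, \<open>v\<close> would be trivial.\<close>
  have "p dvd card V"
  proof (rule ccontr)
    assume "\<not> p dvd card V"
    then have "coprime p (card V)" using p(1) prime_imp_coprime by blast
    then have "v = \<one>"
      using pow_coprime_eq_one[OF V.mem_carrier[OF \<open>v \<in> V\<close>] \<open>v [^] p = \<one>\<close> \<open>v [^] card V = \<one>\<close>] by simp
    then show False using \<open>v \<noteq> \<one>\<close> by simp
  qed
  obtain P where P: "subgroup P G" "card P = p ^ multiplicity p (order G)"
    using obtains_sylow_subgroup[OF fin p(1)] .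
  interpret P: group_action "G\<lparr>carrier := P\<rparr>" V "\<lambda>g. \<lambda>v\<in>V. g \<otimes> v \<otimes> inv g"
    using V.inv_op_closed2[OF subgroup.mem_carrier[OF P(1)]]
    by (rule subgroup_conjugation_action[OF P(1) V.subset])
  have *: "order (G\<lparr>carrier := P\<rparr>) = p ^ multiplicity p (order G)" using P by (simp add: order_def)
  \<comment> \<open>The known fixed point is \<open>\<one>\<close>; since \<open>p\<close> divides
    \<open>card V\<close>, there is a second one.\<close>
  have "(\<lambda>v\<in>V. g \<otimes> v \<otimes> inv g) \<one> = \<one>" if "g \<in> carrier (G\<lparr>carrier := P\<rparr>)" for g
    using that subgroup.mem_carrier[OF P(1)] by simp
  from P.prime_power_order_fixed_point[OF p(1) * finV \<open>p dvd card V\<close> V.one_closed this]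
  obtain y where y: "y \<in> V" "y \<noteq> \<one>" "\<And>g. g \<in> P \<Longrightarrow> g \<otimes> y \<otimes> inv g = y"
    by auto
  have yG: "y \<in> carrier G" using y V.mem_carrier by blast
  \<comment> \<open>The centralizer of \<open>y\<close>. It contains \<open>P\<close> by the choice
    of \<open>y\<close>, and it remains to treat the Sylow subgroups for the other primes.\<close>
  let ?C = "{g \<in> carrier G. commutator G y g \<in> {\<one>}}"
  have "?C = carrier G"
  proof (rule subgroup_eq_carrier_if_sylow_subgroups[OF fin])
    show "subgroup ?C G" using subgroup_centralizer_modulo[OF one_is_normal yG] .
    fix q :: nat assume q: "prime q"
    show "\<exists>P\<subseteq>?C. subgroup P G \<and> card P = q ^ multiplicity q (order G)"
    proof (cases "q = p")
      case True
      have "P \<subseteq> ?C"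
      proof
        fix g assume g: "g \<in> P"
        then have gG: "g \<in> carrier G" using subgroup.mem_carrier[OF P(1)] by simp
        then have "g \<otimes> y = y \<otimes> g"
          using y(3)[OF g] yG gG inv_solve_right'[of y "g \<otimes> y" g] by simp
        then show "g \<in> ?C" using gG yG commutator_eq_one_iff by simp
      qed
      then show ?thesis using P True by blast
    next
      case False
      obtain Q where Q: "subgroup Q G" "card Q = q ^ multiplicity q (order G)"
        using obtains_sylow_subgroup[OF fin q] .
      have "Q \<subseteq> ?C"
      proof
        fix h assume h: "h \<in> Q"
        then have hG: "h \<in> carrier G" using subgroup.mem_carrier[OF Q(1)] by simp
        have comm_V: "commutator G w h \<in> V" if "w \<in> V" for w
          using subset_central_modulo[OF V.normal_axioms] that hG by (auto simp: central_modulo_def)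
        have "h [^] card Q = \<one>"
          using group.pow_order_eq_1[OF subgroup_imp_group[OF Q(1)], of h] h
          by (simp add: order_def nat_pow_consistent[symmetric])
        moreover have "coprime p (card Q)"
          using Q(2) p(1) q False by (simp add: primes_coprime)
        \<comment> \<open>For \<open>w\<close> in \<open>V\<close>, the commutator
          \<open>[w, h]\<close> has exponent \<open>p\<close>, while \<open>h\<close> has an
          exponent prime to \<open>p\<close>, so a vanishing \<open>[w, h, h]\<close> already forces
          \<open>[w, h]\<close> to vanish.\<close>
        ultimately have step: "commutator G w h = \<one>"
          if "w \<in> V" "commutator G (commutator G w h) h = \<one>" for w
        proof -
          have "commutator G w h \<in> V" using comm_V that(1) .
          then have "commutator G w h [^] p = \<one>" unfolding V_def by simp
          then show ?thesis
            using commutator_eq_one_if_coprime[of w h "card Q" p] that hG V.mem_carrier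
              \<open>h [^] card Q = \<one>\<close> \<open>coprime p (card Q)\<close> by simp
        qed
        obtain k where k: "engel_commutator G y k h = \<one>"
          using engel y(1) hG unfolding V_def by blast
        have inV: "engel_commutator G y j h \<in> V" for j
          by (induction j) (use y(1) comm_V in auto)
        \<comment> \<open>Repeated use of \<open>step\<close> shortens the Engel commutator down to
          \<open>[y, h]\<close>.\<close>
        have "engel_commutator G y (Suc j) h = \<one> \<Longrightarrow> commutator G y h = \<one>" for j
        proof (induction j)
          case (Suc j)
          then show ?case using step[OF inV[of j]] by simp
        qed simp
        moreover have "engel_commutator G y (Suc k) h = \<one>" using k hG by simp
        ultimately show "h \<in> ?C" using hG by simp
      qed
      then show ?thesis using Q by blast
    qed
  qed
  then have "y \<otimes> g = g \<otimes> y" if "g \<in> carrier G" for g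
    using that yG commutator_eq_one_iff[of y g] by blast
  then show ?thesis using y(1,2) unfolding V_def by blast
qed

end

section \<open>Normalizers, conjugates and maximal subgroups\<close>

definition maximal_subgroup :: "'a set \<Rightarrow> ('a, 'b) monoid_scheme \<Rightarrow> bool" where
  "maximal_subgroup M G \<longleftrightarrow> subgroup M G \<and> M \<noteq> carrier G \<and>
     (\<forall>K. subgroup K G \<longrightarrow> M \<subseteq> K \<longrightarrow> K = M \<or> K = carrier G)"

text \<open>The conjugate of \<open>H\<close> by \<open>g\<close>, with \<open>g\<close> inverted on
  the left. As a preimage it unfolds directly to a membership in \<open>H\<close>, and it gives a
  right action.\<close>

definition conjugate_subset :: "('a, 'b) monoid_scheme \<Rightarrow> 'a set \<Rightarrow> 'a \<Rightarrow> 'a set" where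
  "conjugate_subset G H g = {x \<in> carrier G. g \<otimes>\<^bsub>G\<^esub> x \<otimes>\<^bsub>G\<^esub> inv\<^bsub>G\<^esub> g \<in> H}"

context group
begin

lemma obtains_maximal_subgroup:
  assumes "finite (carrier G)" "subgroup H G" "H \<noteq> carrier G"
  obtains M where "maximal_subgroup M G" "H \<subseteq> M"
proof -
  let ?A = "{K. subgroup K G \<and> K \<noteq> carrier G}"
  have "?A \<subseteq> Pow (carrier G)" using subgroup.subset by blast
  then have "finite ?A" using assms(1) finite_subset by blast
  then obtain M where "M \<in> ?A" "H \<subseteq> M" "\<forall>K\<in>?A. M \<subseteq> K \<longrightarrow> M = K"
    using finite_has_maximal2[of ?A H] assms by auto
  then show thesis using that[of M] unfolding maximal_subgroup_def by blast
qed

text \<open>Asking for an equivalence and not just an inclusion gives closure under inverses even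
  for infinite \<open>I\<close>.\<close>

lemma subgroup_normalizer:
  "subgroup {x \<in> carrier G. \<forall>m\<in>carrier G. m \<in> I \<longleftrightarrow> inv x \<otimes> m \<otimes> x \<in> I} G" (is "subgroup ?N G")
proof (rule subgroupI)
  have "\<one> \<in> ?N" by simp
  then show "?N \<noteq> {}" by blast
next
  fix x assume x: "x \<in> ?N"
  then have xG: "x \<in> carrier G" by blast
  have "m \<in> I \<longleftrightarrow> inv (inv x) \<otimes> m \<otimes> inv x \<in> I" if m: "m \<in> carrier G" for m
  proof -
    have "x \<otimes> m \<otimes> inv x \<in> carrier G" using xG m by simp
    then have "x \<otimes> m \<otimes> inv x \<in> I \<longleftrightarrow> inv x \<otimes> (x \<otimes> m \<otimes> inv x) \<otimes> x \<in> I" using x by blast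
    then show ?thesis using xG m by (simp add: group_word_simps)
  qed
  then show "inv x \<in> ?N" using inv_closed[OF xG] by blast
next
  fix x y assume x: "x \<in> ?N" and y: "y \<in> ?N"
  then have G: "x \<in> carrier G" "y \<in> carrier G" by blast+
  have "m \<in> I \<longleftrightarrow> inv (x \<otimes> y) \<otimes> m \<otimes> (x \<otimes> y) \<in> I" if m: "m \<in> carrier G" for m
  proof -
    have "m \<in> I \<longleftrightarrow> inv x \<otimes> m \<otimes> x \<in> I" using x m by blast
    also have "inv x \<otimes> m \<otimes> x \<in> carrier G" using G m by simp
    then have "inv x \<otimes> m \<otimes> x \<in> I \<longleftrightarrow> inv y \<otimes> (inv x \<otimes> m \<otimes> x) \<otimes> y \<in> I" using y by blast
    also have "inv y \<otimes> (inv x \<otimes> m \<otimes> x) \<otimes> y = inv (x \<otimes> y) \<otimes> m \<otimes> (x \<otimes> y)"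
      using G m by (simp add: group_word_simps)
    finally show ?thesis .
  qed
  then show "x \<otimes> y \<in> ?N" using m_closed[OF G] by blast
qed blast

text \<open>An injective map of a finite set into itself is onto, so one inclusion suffices.\<close>

lemma in_normalizer_if_finite:
  assumes "finite I" "I \<subseteq> carrier G" "x \<in> carrier G" "\<And>m. m \<in> I \<Longrightarrow> inv x \<otimes> m \<otimes> x \<in> I"
  shows "x \<in> {x \<in> carrier G. \<forall>m\<in>carrier G. m \<in> I \<longleftrightarrow> inv x \<otimes> m \<otimes> x \<in> I}"
proof -
  have inj: "inj_on (\<lambda>m. inv x \<otimes> m \<otimes> x) (carrier G)"
    using assms(3) by (intro inj_onI) simp
  then have "(\<lambda>m. inv x \<otimes> m \<otimes> x) ` I = I"
    using assms by (intro endo_inj_surj) (auto intro: inj_on_subset)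
  then have "m \<in> I" if m: "m \<in> carrier G" "inv x \<otimes> m \<otimes> x \<in> I" for m
    using inj_on_image_mem_iff[OF inj m(1) assms(2)] m(2) by simp
  then show ?thesis using assms by blast
qed

lemma normal_if_normalizer_eq_carrier:
  assumes "subgroup I G"
    and "{x \<in> carrier G. \<forall>m\<in>carrier G. m \<in> I \<longleftrightarrow> inv x \<otimes> m \<otimes> x \<in> I} = carrier G"
  shows "I \<lhd> G"
proof -
  have "x \<otimes> h \<otimes> inv x \<in> I" if x: "x \<in> carrier G" and h: "h \<in> I" for x h
  proof -
    have hG: "h \<in> carrier G" using subgroup.mem_carrier[OF assms(1) h] .
    then have "x \<otimes> h \<otimes> inv x \<in> I \<longleftrightarrow> inv x \<otimes> (x \<otimes> h \<otimes> inv x) \<otimes> x \<in> I"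
      using x assms(2) by blast
    then show ?thesis using h x hG by (simp add: group_word_simps)
  qed
  then show ?thesis using assms(1) normal_inv_iff by blast
qed

text \<open>An element of \<open>M\<close> outside \<open>I\<close> whose commutators with all of
  \<open>M\<close> lie in \<open>I\<close> has in particular its commutators with \<open>I\<close>
  there, so it conjugates \<open>I\<close> into itself.\<close>

lemma nilpotent_subgroup_normalizer_grows:
  assumes M: "subgroup M G" "nilpotent_group (G\<lparr>carrier := M\<rparr>)"
    and I: "subgroup I G" "I \<subset> M"
  obtains x where "x \<in> M" "x \<notin> I" "\<And>m. m \<in> I \<Longrightarrow> inv x \<otimes> m \<otimes> x \<in> I"
proof -
  interpret M: group "G\<lparr>carrier := M\<rparr>" using subgroup_imp_group[OF M(1)] .
  have "\<one> \<in> I" "\<not> M \<subseteq> I" using I subgroup.one_closed by auto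
  then obtain x where x: "x \<in> M" "x \<notin> I"
    and *: "\<And>g. g \<in> M \<Longrightarrow> commutator (G\<lparr>carrier := M\<rparr>) x g \<in> I"
    using M.nilpotent_obtains_central_modulo[OF M(2), of I] by auto
  have "inv x \<otimes> m \<otimes> x \<in> I" if m: "m \<in> I" for m
  proof -
    have "commutator G x m \<in> I"
      using *[of m] m I(2) x commutator_consistent[OF M(1), of x m] by auto
    then show ?thesis
      using subgroup_commutator_closed_iff[OF I(1) subgroup.mem_carrier[OF M(1) x(1)] m] by simp
  qed
  then show thesis using that x by blast
qed

section \<open>Conjugates of subgroups\<close>

lemma conjugate_subset_mult:
  assumes "g \<in> carrier G" "h \<in> carrier G"
  shows "conjugate_subset G (conjugate_subset G H h) g = conjugate_subset G H (h \<otimes> g)"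
  using assms by (auto simp: conjugate_subset_def group_word_simps)

lemma conjugate_subset_one: "H \<subseteq> carrier G \<Longrightarrow> conjugate_subset G H \<one> = H"
  by (auto simp: conjugate_subset_def)

lemma conjugate_subset_carrier: "g \<in> carrier G \<Longrightarrow> conjugate_subset G (carrier G) g = carrier G"
  by (auto simp: conjugate_subset_def)

lemma subgroup_conjugate_subset:
  assumes "subgroup H G" "g \<in> carrier G"
  shows "subgroup (conjugate_subset G H g) G"
proof (rule subgroupI)
  have "\<one> \<in> conjugate_subset G H g"
    using assms by (simp add: conjugate_subset_def subgroup.one_closed)
  then show "conjugate_subset G H g \<noteq> {}" by blast
next
  fix x assume x: "x \<in> conjugate_subset G H g"
  then have "inv (g \<otimes> x \<otimes> inv g) \<in> H"
    using assms by (simp add: conjugate_subset_def subgroup.m_inv_closed)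
  then show "inv x \<in> conjugate_subset G H g"
    using assms x by (simp add: conjugate_subset_def group_word_simps)
next
  fix x y assume xy: "x \<in> conjugate_subset G H g" "y \<in> conjugate_subset G H g"
  then have "(g \<otimes> x \<otimes> inv g) \<otimes> (g \<otimes> y \<otimes> inv g) \<in> H"
    using assms by (simp add: conjugate_subset_def subgroup.m_closed)
  then show "x \<otimes> y \<in> conjugate_subset G H g"
    using assms xy by (simp add: conjugate_subset_def group_word_simps)
qed (auto simp: conjugate_subset_def)

text \<open>Conjugation by \<open>g\<close> preserves inclusions of subgroups and is undone by
  conjugation by \<open>inv g\<close>.\<close>

lemma maximal_subgroup_conjugate_subset:
  assumes M: "maximal_subgroup M G" and g: "g \<in> carrier G"
  shows "maximal_subgroup (conjugate_subset G M g) G"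
proof -
  have sub: "conjugate_subset G (conjugate_subset G K (inv g)) g = K"
    "conjugate_subset G (conjugate_subset G K g) (inv g) = K" if "subgroup K G" for K
    using g subgroup.subset[OF that]
    by (simp_all add: conjugate_subset_mult conjugate_subset_one)
  have M': "subgroup M G" "M \<noteq> carrier G"
    and max: "\<And>K. subgroup K G \<Longrightarrow> M \<subseteq> K \<Longrightarrow> K = M \<or> K = carrier G"
    using M unfolding maximal_subgroup_def by blast+
  have "K = conjugate_subset G M g \<or> K = carrier G"
    if K: "subgroup K G" "conjugate_subset G M g \<subseteq> K" for K
  proof -
    have "conjugate_subset G (conjugate_subset G M g) (inv g) \<subseteq> conjugate_subset G K (inv g)"
      using K(2) by (auto simp: conjugate_subset_def)
    then have "M \<subseteq> conjugate_subset G K (inv g)" using sub(2)[OF M'(1)] by simp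
    then have "conjugate_subset G K (inv g) = M \<or> conjugate_subset G K (inv g) = carrier G"
      using max subgroup_conjugate_subset[OF K(1)] g by simp
    then show ?thesis using sub(1)[OF K(1)] conjugate_subset_carrier[OF g] by metis
  qed
  moreover have "conjugate_subset G M g \<noteq> carrier G"
    using sub(2)[OF M'(1)] M'(2) conjugate_subset_carrier[of "inv g"] g by auto
  ultimately show ?thesis
    unfolding maximal_subgroup_def using subgroup_conjugate_subset[OF M'(1) g] by blast
qed

text \<open>Applied in the quotient \<open>G Mod Z\<close>, where the image of \<open>N\<close> has a nontrivial centre as long as
  \<open>N\<close> is not contained in \<open>Z\<close>.\<close>
lemma right_engel_normal_nilpotent_subset:
  assumes fin: "finite (carrier G)" and "Z \<lhd> G" and Z: "central_modulo G Z = Z"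
    and "N \<lhd> G" and nil: "nilpotent_group (G\<lparr>carrier := N\<rparr>)"
    and engel: "\<And>n g. n \<in> N \<Longrightarrow> g \<in> carrier G \<Longrightarrow> \<exists>k. engel_commutator G n k g = \<one>"
  shows "N \<subseteq> Z"
proof (rule ccontr)
  assume NZ: "\<not> N \<subseteq> Z"
  interpret Z: normal Z G by fact
  interpret N: normal N G by fact
  interpret NG: group "G\<lparr>carrier := N\<rparr>" using subgroup_imp_group[OF N.subgroup_axioms] .
  let ?Q = "G Mod Z" and ?h = "\<lambda>a. Z #> a"
  interpret Q: group ?Q by (rule Z.factorgroup_is_group)
  interpret h: group_hom G ?Q ?h
    by unfold_locales (rule Z.r_coset_hom_Mod)
  have h_one: "?h x = \<one>\<^bsub>?Q\<^esub> \<longleftrightarrow> x \<in> Z" if "x \<in> carrier G" for x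
    using that coset_join1[of Z x] coset_join2[of x Z] Z.subset Z.subgroup_axioms
    by (auto simp: FactGroup_def)
  have h_comm: "?h x \<otimes>\<^bsub>?Q\<^esub> ?h y = ?h y \<otimes>\<^bsub>?Q\<^esub> ?h x \<longleftrightarrow> commutator G x y \<in> Z"
    if "x \<in> carrier G" "y \<in> carrier G" for x y
    using that h_one[of "commutator G x y"] Q.commutator_eq_one_iff[of "?h x" "?h y"]
    by (simp add: h.hom_commutator)
  have carrier_Q: "carrier ?Q = ?h ` carrier G" by (auto simp: FactGroup_def RCOSETS_def)
  have normal: "?h ` N \<lhd> ?Q"
    unfolding Q.normal_inv_iff
  proof (intro conjI ballI)
    show "subgroup (?h ` N) ?Q" by (rule h.subgroup_img_is_subgroup) (rule N.subgroup_axioms)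
    fix q b assume "q \<in> carrier ?Q" "b \<in> ?h ` N"
    then obtain g n where "g \<in> carrier G" "q = ?h g" "n \<in> N" "b = ?h n"
      using carrier_Q by blast
    moreover from this have "?h (g \<otimes> n \<otimes> inv g) = q \<otimes>\<^bsub>?Q\<^esub> b \<otimes>\<^bsub>?Q\<^esub> inv\<^bsub>?Q\<^esub> q"
      using N.mem_carrier by simp
    ultimately show "q \<otimes>\<^bsub>?Q\<^esub> b \<otimes>\<^bsub>?Q\<^esub> inv\<^bsub>?Q\<^esub> q \<in> ?h ` N"
      using imageI[OF N.inv_op_closed2[of g n], of ?h] by simp
  qed
  \<comment> \<open>The image of \<open>y\<close> is a nontrivial central element of the image of
    \<open>N\<close>.\<close>
  obtain y where y: "y \<in> N" "y \<notin> Z" "\<And>n. n \<in> N \<Longrightarrow> commutator G y n \<in> Z"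
    using NG.nilpotent_obtains_central_modulo[OF nil, of Z] NZ Z.one_closed
      commutator_consistent[OF N.subgroup_axioms] by auto
  have "finite (carrier ?Q)" using carrier_Q fin by simp
  have "?h y \<noteq> \<one>\<^bsub>?Q\<^esub>" using h_one[OF N.mem_carrier[OF y(1)]] y(2) by simp
  have central: "?h y \<otimes>\<^bsub>?Q\<^esub> b = b \<otimes>\<^bsub>?Q\<^esub> ?h y" if b: "b \<in> ?h ` N" for b
  proof -
    obtain n where n: "n \<in> N" "b = ?h n" using b by (rule imageE)
    then show ?thesis
      using y(3)[OF n(1)] h_comm[OF N.mem_carrier[OF y(1)] N.mem_carrier[OF n(1)]] by blast
  qed
  have engel_Q: "\<exists>k. engel_commutator ?Q b k q = \<one>\<^bsub>?Q\<^esub>"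
    if bq: "b \<in> ?h ` N" "q \<in> carrier ?Q" for b q
  proof -
    obtain n g where *: "n \<in> N" "b = ?h n" "g \<in> carrier G" "q = ?h g"
      using bq carrier_Q by blast
    obtain k where "engel_commutator G n k g = \<one>" using engel * by blast
    then have "engel_commutator ?Q b k q = \<one>\<^bsub>?Q\<^esub>"
      using * N.mem_carrier h.hom_engel_commutator[of n g k] h.hom_one by simp
    then show ?thesis by blast
  qed
  have "\<exists>q\<in>?h ` N. q \<noteq> \<one>\<^bsub>?Q\<^esub> \<and> (\<forall>b\<in>carrier ?Q. q \<otimes>\<^bsub>?Q\<^esub> b = b \<otimes>\<^bsub>?Q\<^esub> q)"
    by (rule Q.right_engel_normal_ex_central[OF \<open>finite (carrier ?Q)\<close> normal
          imageI[OF y(1)] \<open>?h y \<noteq> \<one>\<^bsub>?Q\<^esub>\<close> central engel_Q])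
  then obtain q where q: "q \<in> ?h ` N" "q \<noteq> \<one>\<^bsub>?Q\<^esub>"
    "\<And>b. b \<in> carrier ?Q \<Longrightarrow> q \<otimes>\<^bsub>?Q\<^esub> b = b \<otimes>\<^bsub>?Q\<^esub> q"
    by blast
  then obtain w where w: "w \<in> N" "q = ?h w" by blast
  \<comment> \<open>Pulled back to \<open>G\<close>, centrality of \<open>q\<close> puts
    \<open>w\<close> into \<open>central_modulo G Z\<close>, that is into \<open>Z\<close>, although
    its image \<open>q\<close> is nontrivial.\<close>
  then have "commutator G w g \<in> Z" if "g \<in> carrier G" for g
    using q(3)[OF h.hom_closed[OF that]] h_comm[OF N.mem_carrier[OF w(1)] that] w(2) by simp
  then have "w \<in> central_modulo G Z" using w N.mem_carrier by (simp add: central_modulo_def)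
  then show False using Z w q(2) h_one[OF N.mem_carrier[OF w(1)]] by simp
qed

end

section \<open>Groups with a symmetric Engel relation\<close>

definition engel_symmetric :: "('a, 'b) monoid_scheme \<Rightarrow> bool" where
  "engel_symmetric G \<longleftrightarrow> (\<forall>x\<in>carrier G. \<forall>y\<in>carrier G.
     (\<exists>k. engel_commutator G x k y = \<one>\<^bsub>G\<^esub>) \<longrightarrow> (\<exists>k. engel_commutator G y k x = \<one>\<^bsub>G\<^esub>))"

text \<open>The first commutator \<open>[g, n]\<close> already lies in \<open>N\<close>, where
  nilpotency kills \<open>[g, n, ..., n]\<close>. Symmetry then exchanges \<open>g\<close> and
  \<open>n\<close>.\<close>

lemma (in group) nilpotent_normal_right_engel:
  assumes "engel_symmetric G" "N \<lhd> G" "nilpotent_group (G\<lparr>carrier := N\<rparr>)"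
    and n: "n \<in> N" and g: "g \<in> carrier G"
  shows "\<exists>k. engel_commutator G n k g = \<one>"
proof -
  interpret N: normal N G by fact
  interpret NG: group "G\<lparr>carrier := N\<rparr>" using subgroup_imp_group[OF N.subgroup_axioms] .
  obtain c where "\<And>x y. x \<in> N \<Longrightarrow> y \<in> N \<Longrightarrow>
      engel_commutator (G\<lparr>carrier := N\<rparr>) x (Suc c) y = \<one>"
    using NG.nilpotent_imp_engel[OF assms(3)] by auto
  moreover have c: "commutator G g n \<in> N"
  proof -
    have "commutator G n g \<in> N"
      using subset_central_modulo[OF assms(2)] n g by (auto simp: central_modulo_def)
    then show ?thesis using commutator_inv[of n g] n g N.mem_carrier N.m_inv_closed by metis
  qed
  ultimately have "engel_commutator G (commutator G g n) (Suc c) n = \<one>"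
    using engel_commutator_consistent(1)[OF N.subgroup_axioms] n by metis
  then have "engel_commutator G g (1 + Suc c) n = \<one>"
    unfolding engel_commutator_add by simp
  then show ?thesis
    using assms(1) N.mem_carrier[OF n] g unfolding engel_symmetric_def by blast
qed

text \<open>A minimal counterexample to nilpotency. Its maximal subgroups turn out to be self-normalizing
  and to intersect pairwise in the hypercentre \<open>Z\<close>.\<close>
locale engel_symmetric_minimal = group G for G (structure) +
  fixes n :: nat and Z :: "'a set"
  assumes fin: "finite (carrier G)"
    and sym: "engel_symmetric G"
    and proper_nilpotent:
      "\<And>H. subgroup H G \<Longrightarrow> H \<noteq> carrier G \<Longrightarrow> nilpotent_group (G\<lparr>carrier := H\<rparr>)"
    and Z_def: "Z = upper_central_series G n"
    and Z_stable: "central_modulo G Z = Z"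
    and Z_proper: "Z \<noteq> carrier G"
begin

sublocale Z: normal Z G
  unfolding Z_def by (rule normal_upper_central_series)

section \<open>Maximal subgroups of a minimal counterexample\<close>

lemma maximalD:
  assumes "maximal_subgroup M G"
  shows "subgroup M G" "M \<noteq> carrier G" "M \<subseteq> carrier G" "finite M"
    "\<And>K. subgroup K G \<Longrightarrow> M \<subseteq> K \<Longrightarrow> K \<noteq> carrier G \<Longrightarrow> K = M"
proof -
  have M: "subgroup M G" "M \<noteq> carrier G"
    "\<And>K. subgroup K G \<Longrightarrow> M \<subseteq> K \<Longrightarrow> K = M \<or> K = carrier G"
    using assms unfolding maximal_subgroup_def by blast+
  show "subgroup M G" "M \<noteq> carrier G" by fact+
  show "M \<subseteq> carrier G" using subgroup.subset[OF M(1)] .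
  then show "finite M" using fin by (rule finite_subset)
  show "K = M" if "subgroup K G" "M \<subseteq> K" "K \<noteq> carrier G" for K
    using M(3)[OF that(1,2)] that(3) by blast
qed

lemma normal_subset_Z:
  assumes "N \<lhd> G" "N \<noteq> carrier G"
  shows "N \<subseteq> Z"
proof -
  have "nilpotent_group (G\<lparr>carrier := N\<rparr>)"
    using proper_nilpotent normal_imp_subgroup assms by blast
  then show ?thesis
    by (intro right_engel_normal_nilpotent_subset[OF fin Z.normal_axioms Z_stable assms(1)]
        nilpotent_normal_right_engel[OF sym assms(1)])
qed

text \<open>Places an element outside \<open>Z\<close> in a proper subgroup. Properness holds
  because otherwise \<open>x\<close> would be central modulo \<open>Z\<close>, and \<open>Z\<close>
  is stable.\<close>

lemma subgroup_centralizer_modulo_Z: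
  assumes "x \<in> carrier G" "x \<notin> Z"
  defines "C \<equiv> {g \<in> carrier G. commutator G x g \<in> Z}"
  shows "subgroup C G" "C \<noteq> carrier G" "x \<in> C" "Z \<subseteq> C"
proof -
  show "subgroup C G"
    unfolding C_def using subgroup_centralizer_modulo[OF Z.normal_axioms assms(1)] .
  have "C \<noteq> carrier G"
  proof
    assume "C = carrier G"
    then have "x \<in> central_modulo G Z"
      using assms(1) unfolding central_modulo_def C_def by blast
    then show False using Z_stable assms(2) by simp
  qed
  then show "C \<noteq> carrier G" .
  show "x \<in> C" using assms(1) by (simp add: C_def)
  show "Z \<subseteq> C"
  proof
    fix z assume z: "z \<in> Z"
    then have "commutator G z x \<in> Z"
      using subset_central_modulo[OF Z.normal_axioms] assms(1) by (auto simp: central_modulo_def)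
    then have "commutator G x z \<in> Z"
      using commutator_inv[of z x] Z.mem_carrier[OF z] assms(1) Z.m_inv_closed by metis
    then show "z \<in> C" using Z.mem_carrier[OF z] by (simp add: C_def)
  qed
qed

text \<open>Otherwise \<open>M = Z\<close>, and the centralizer modulo \<open>Z\<close> of an
  element outside \<open>Z\<close> is a larger proper subgroup.\<close>

lemma maximal_not_subset_Z:
  assumes "maximal_subgroup M G"
  shows "\<not> M \<subseteq> Z"
proof
  assume "M \<subseteq> Z"
  then have "M = Z" using maximalD(5)[OF assms Z.subgroup_axioms] Z_proper by blast
  obtain x where x: "x \<in> carrier G" "x \<notin> Z" using Z_proper Z.subset by blast
  note C = subgroup_centralizer_modulo_Z[OF x]
  show False using maximalD(5)[OF assms C(1) _ C(2)] C(3,4) x \<open>M = Z\<close> by blast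
qed

text \<open>If \<open>x\<close> were outside \<open>M\<close>, the normalizer would be all of
  \<open>G\<close>; then \<open>M\<close> would be normal and hence inside \<open>Z\<close>.\<close>

lemma maximal_self_normalizing:
  assumes M: "maximal_subgroup M G"
    and x: "x \<in> carrier G" "\<And>m. m \<in> M \<Longrightarrow> inv x \<otimes> m \<otimes> x \<in> M"
  shows "x \<in> M"
proof (rule ccontr)
  assume "x \<notin> M"
  let ?N = "{x \<in> carrier G. \<forall>m\<in>carrier G. m \<in> M \<longleftrightarrow> inv x \<otimes> m \<otimes> x \<in> M}"
  note m = maximalD[OF M]
  have "M \<subseteq> ?N"
  proof
    fix y assume y: "y \<in> M"
    have "inv y \<otimes> z \<otimes> y \<in> M" if "z \<in> M" for z
      using y that m(1) by (simp add: subgroup.m_closed subgroup.m_inv_closed)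
    then show "y \<in> ?N" using in_normalizer_if_finite[OF m(4,3)] y m(3) by blast
  qed
  moreover have "x \<in> ?N" using in_normalizer_if_finite[OF m(4,3) x] .
  ultimately have "?N = carrier G" using m(5)[OF subgroup_normalizer] \<open>x \<notin> M\<close> by blast
  then have "M \<lhd> G" by (rule normal_if_normalizer_eq_carrier[OF m(1)])
  then show False using normal_subset_Z m(2) maximal_not_subset_Z[OF M] by blast
qed

text \<open>Climbs the upper central series: if one term lies in \<open>M\<close>, elements of the
  next have their commutators in \<open>M\<close>, so they normalize \<open>M\<close> and belong to
  it.\<close>

lemma Z_subset_maximal:
  assumes M: "maximal_subgroup M G"
  shows "Z \<subseteq> M"
proof -
  have "upper_central_series G i \<subseteq> M" for i
  proof (induction i)
    case 0
    show ?case using subgroup.one_closed[OF maximalD(1)[OF M]] by simp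
  next
    case (Suc i)
    show ?case
    proof
      fix x assume "x \<in> upper_central_series G (Suc i)"
      then have x: "x \<in> carrier G" "\<And>g. g \<in> carrier G \<Longrightarrow> commutator G x g \<in> M"
        using Suc by (auto simp: central_modulo_def)
      have "inv x \<otimes> m \<otimes> x \<in> M" if "m \<in> M" for m
        using subgroup_commutator_closed_iff[OF maximalD(1)[OF M] x(1) that] x(2)
          maximalD(3)[OF M] that by blast
      then show "x \<in> M" using maximal_self_normalizing[OF M x(1)] by blast
    qed
  qed
  then show ?thesis unfolding Z_def .
qed

text \<open>A largest intersection \<open>I\<close> is shown to be normal, hence inside
  \<open>Z\<close>. Any other intersection is no larger than \<open>I\<close>, yet it contains
  \<open>Z\<close>.\<close>

lemma maximal_inter_subset_Z:
  assumes "maximal_subgroup M G" "maximal_subgroup M' G" "M \<noteq> M'"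
  shows "M \<inter> M' \<subseteq> Z"
proof -
  let ?P = "\<lambda>(M, M'). maximal_subgroup M G \<and> maximal_subgroup M' G \<and> M \<noteq> M'"
  let ?f = "\<lambda>(M, M'). card (M \<inter> M')"
  have "?f q < Suc (card (carrier G))" if "?P q" for q
  proof -
    have "fst q \<inter> snd q \<subseteq> carrier G" using that maximalD(3) by (cases q) auto
    then show ?thesis using card_mono[OF fin] by (cases q) (simp add: less_Suc_eq_le)
  qed
  then obtain q where q: "?P q" "\<And>q'. ?P q' \<Longrightarrow> ?f q' \<le> ?f q"
    using ex_has_greatest_nat[of ?P "(M, M')" ?f "Suc (card (carrier G))"] assms by auto
  obtain M1 M2 where "q = (M1, M2)" by (cases q)
  with q have M1: "maximal_subgroup M1 G" and M2: "maximal_subgroup M2 G" and "M1 \<noteq> M2"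
    and greatest: "\<And>M M'. maximal_subgroup M G \<Longrightarrow> maximal_subgroup M' G \<Longrightarrow> M \<noteq> M' \<Longrightarrow>
      card (M \<inter> M') \<le> card (M1 \<inter> M2)"
    by auto
  define I where "I = M1 \<inter> M2"
  have I: "subgroup I G"
    unfolding I_def using subgroups_Inter_pair maximalD(1) M1 M2 by blast
  have finI: "finite I" "I \<subseteq> carrier G"
    unfolding I_def using maximalD(3,4)[OF M1] by auto
  define N where "N = {x \<in> carrier G. \<forall>m\<in>carrier G. m \<in> I \<longleftrightarrow> inv x \<otimes> m \<otimes> x \<in> I}"
  have N: "subgroup N G" unfolding N_def by (rule subgroup_normalizer)
  have in_N: "x \<in> N" if "x \<in> carrier G" "\<And>m. m \<in> I \<Longrightarrow> inv x \<otimes> m \<otimes> x \<in> I" for x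
    unfolding N_def using that by (rule in_normalizer_if_finite[OF finI])
  have I_N: "I \<subseteq> N"
  proof
    fix y assume y: "y \<in> I"
    have "inv y \<otimes> z \<otimes> y \<in> I" if "z \<in> I" for z
      using y that I by (simp add: subgroup.m_closed subgroup.m_inv_closed)
    then show "y \<in> N" using in_N y finI(2) by blast
  qed
  have grow: "\<exists>x\<in>L. x \<notin> I \<and> x \<in> N" if L: "maximal_subgroup L G" "I \<subset> L" for L
  proof -
    note l = maximalD[OF L(1)]
    obtain x where "x \<in> L" "x \<notin> I" "\<And>m. m \<in> I \<Longrightarrow> inv x \<otimes> m \<otimes> x \<in> I"
      using nilpotent_subgroup_normalizer_grows[OF l(1) proper_nilpotent[OF l(1,2)] I L(2)] by blast
    then show ?thesis using in_N[of x] l(3) by blast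
  qed
  have "I \<subset> M1"
    using \<open>M1 \<noteq> M2\<close> maximalD(5)[OF M1 maximalD(1)[OF M2] _ maximalD(2)[OF M2]] unfolding I_def by blast
  have "I \<subset> M2"
    using \<open>M1 \<noteq> M2\<close> maximalD(5)[OF M2 maximalD(1)[OF M1] _ maximalD(2)[OF M1]] unfolding I_def by blast
  have "N = carrier G"
  proof (rule ccontr)
    assume "N \<noteq> carrier G"
    then obtain M3 where M3: "maximal_subgroup M3 G" "N \<subseteq> M3"
      using obtains_maximal_subgroup[OF fin N] by blast
    \<comment> \<open>The normalizer of \<open>I\<close> grows inside \<open>L\<close> and lies in
      \<open>M3\<close>, so \<open>L\<close> and \<open>M3\<close> share more than \<open>I\<close>.
      If they were distinct, this would contradict the choice of \<open>I\<close>; but then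
      \<open>M1\<close> and \<open>M2\<close> both equal \<open>M3\<close>.\<close>
    have "L = M3" if L: "maximal_subgroup L G" "I \<subset> L" for L
    proof (rule ccontr)
      assume "L \<noteq> M3"
      then have "card (L \<inter> M3) \<le> card I" using greatest[OF L(1) M3(1)] unfolding I_def by blast
      moreover have "I \<subset> L \<inter> M3" using grow[OF L] I_N L(2) M3(2) by blast
      moreover have "finite (L \<inter> M3)" using maximalD(4)[OF L(1)] by blast
      ultimately show False using psubset_card_mono[of "L \<inter> M3" I] by linarith
    qed
    then show False using M1 M2 \<open>I \<subset> M1\<close> \<open>I \<subset> M2\<close> \<open>M1 \<noteq> M2\<close> by metis
  qed
  then have "I \<lhd> G" unfolding N_def by (rule normal_if_normalizer_eq_carrier[OF I])
  moreover have "I \<noteq> carrier G" using \<open>I \<subset> M1\<close> maximalD(3)[OF M1] by blast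
  ultimately have "I \<subseteq> Z" by (rule normal_subset_Z)
  have finZ: "finite Z" using fin Z.subset finite_subset by blast
  have "card (M \<inter> M') \<le> card Z"
    using greatest[OF assms] card_mono[OF finZ \<open>I \<subseteq> Z\<close>] unfolding I_def by linarith
  moreover have "Z \<subseteq> M \<inter> M'" using Z_subset_maximal assms by blast
  moreover have "finite (M \<inter> M')" using maximalD(4)[OF assms(1)] by blast
  ultimately show ?thesis using card_seteq by blast
qed

section \<open>Counting the conjugates of a maximal subgroup outside \<open>Z\<close>\<close>

definition conjugate_union :: "'a set \<Rightarrow> 'a set" where
  "conjugate_union M = {u \<in> carrier G - Z. \<exists>g\<in>carrier G. g \<otimes> u \<otimes> inv g \<in> M}"

lemma conjugate_in_Z_iff:
  assumes "u \<in> carrier G" "g \<in> carrier G"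
  shows "g \<otimes> u \<otimes> inv g \<in> Z \<longleftrightarrow> u \<in> Z"
proof
  assume "g \<otimes> u \<otimes> inv g \<in> Z"
  then have "inv g \<otimes> (g \<otimes> u \<otimes> inv g) \<otimes> g \<in> Z" using assms(2) by (rule Z.inv_op_closed1[rotated])
  then show "u \<in> Z" using assms by (simp add: group_word_simps)
qed (use assms Z.inv_op_closed2 in blast)

text \<open>If \<open>g\<close> and \<open>h\<close> both carry \<open>u\<close> into
  \<open>M\<close>, then \<open>M\<close> and its conjugate by \<open>h \<otimes> inv g\<close>
  share an element outside \<open>Z\<close> and coincide. Since \<open>M\<close> is
  self-normalizing, \<open>h \<otimes> inv g\<close> lies in \<open>M\<close>.\<close>

lemma transporter_eq_coset:
  assumes M: "maximal_subgroup M G"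
    and u: "u \<in> carrier G" "u \<notin> Z" and g: "g \<in> carrier G" "g \<otimes> u \<otimes> inv g \<in> M"
  shows "{h \<in> carrier G. h \<otimes> u \<otimes> inv h \<in> M} = M #> g"
proof (intro subset_antisym subsetI)
  note m = maximalD[OF M]
  fix h assume "h \<in> {h \<in> carrier G. h \<otimes> u \<otimes> inv h \<in> M}"
  then have h: "h \<in> carrier G" "h \<otimes> u \<otimes> inv h \<in> M" by auto
  let ?k = "h \<otimes> inv g" and ?v = "g \<otimes> u \<otimes> inv g"
  have k: "?k \<in> carrier G" and v: "?v \<in> carrier G" using h g u by auto
  have "?k \<otimes> ?v \<otimes> inv ?k = h \<otimes> u \<otimes> inv h"
    using h g u by (simp add: group_word_simps)
  then have "?v \<in> M \<inter> conjugate_subset G M ?k"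
    using h g v unfolding conjugate_subset_def by simp
  moreover have "?v \<notin> Z" using conjugate_in_Z_iff u g(1) by simp
  ultimately have "conjugate_subset G M ?k = M"
    using maximal_inter_subset_Z[OF M maximal_subgroup_conjugate_subset[OF M k]] by blast
  then have "?k \<otimes> z \<otimes> inv ?k \<in> M" if "z \<in> M" for z
    using that unfolding conjugate_subset_def by blast
  then have "inv ?k \<in> M"
    using maximal_self_normalizing[OF M inv_closed[OF k]] inv_inv[OF k] by simp
  then have "?k \<in> M" using subgroup.m_inv_closed[OF m(1)] inv_inv[OF k] by metis
  moreover have "h = ?k \<otimes> g" using h g by (simp add: group_word_simps)
  ultimately show "h \<in> M #> g" unfolding r_coset_def by blast
next
  note m = maximalD[OF M]
  fix h assume "h \<in> M #> g"
  then obtain z where z: "z \<in> M" "h = z \<otimes> g" unfolding r_coset_def by blast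
  have zG: "z \<in> carrier G" using z m(3) by blast
  have "z \<otimes> (g \<otimes> u \<otimes> inv g) \<otimes> inv z \<in> M"
    using z g m(1) by (simp add: subgroup.m_closed subgroup.m_inv_closed)
  then have "h \<otimes> u \<otimes> inv h \<in> M" using z zG u g by (simp add: group_word_simps)
  then show "h \<in> {h \<in> carrier G. h \<otimes> u \<otimes> inv h \<in> M}" using z zG g by simp
qed

text \<open>Counts the pairs \<open>(u, g)\<close> with \<open>u \<notin> Z\<close> and \<open>g u g\<inverse> \<in> M\<close> in two ways.\<close>
lemma card_conjugate_union:
  assumes M: "maximal_subgroup M G"
  shows "card (conjugate_union M) * card M = card (carrier G) * (card M - card Z)"
proof -
  note m = maximalD[OF M]
  let ?R = "\<lambda>u g. g \<otimes> u \<otimes> inv g \<in> M"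
  let ?U = "conjugate_union M"
  have finU: "finite ?U" using fin unfolding conjugate_union_def by simp
  have card_M_Z: "card (M - Z) = card M - card Z"
    using card_Diff_subset[OF finite_subset[OF Z_subset_maximal[OF M] m(4)] Z_subset_maximal[OF M]] .
  \<comment> \<open>For fixed \<open>g\<close>, the admissible \<open>u\<close> are the conjugates
    of \<open>M - Z\<close> by \<open>g\<close>.\<close>
  have fibre_g: "card {u \<in> ?U. ?R u g} = card M - card Z" if g: "g \<in> carrier G" for g
  proof -
    have "bij_betw (\<lambda>v. inv g \<otimes> v \<otimes> g) (M - Z) {u \<in> ?U. ?R u g}"
    proof (rule bij_betw_byWitness[where f' = "\<lambda>u. g \<otimes> u \<otimes> inv g"])
      show "\<forall>v\<in>M - Z. g \<otimes> (inv g \<otimes> v \<otimes> g) \<otimes> inv g = v"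
        using g m(3) by (auto simp: group_word_simps)
      show "\<forall>u\<in>{u \<in> ?U. ?R u g}. inv g \<otimes> (g \<otimes> u \<otimes> inv g) \<otimes> g = u"
        using g unfolding conjugate_union_def by (auto simp: group_word_simps)
      show "(\<lambda>u. g \<otimes> u \<otimes> inv g) ` {u \<in> ?U. ?R u g} \<subseteq> M - Z"
        using g conjugate_in_Z_iff unfolding conjugate_union_def by auto
      show "(\<lambda>v. inv g \<otimes> v \<otimes> g) ` (M - Z) \<subseteq> {u \<in> ?U. ?R u g}"
      proof
        fix u assume "u \<in> (\<lambda>v. inv g \<otimes> v \<otimes> g) ` (M - Z)"
        then obtain v where v: "v \<in> M" "v \<notin> Z" "u = inv g \<otimes> v \<otimes> g" by blast
        have vG: "v \<in> carrier G" using v m(3) by blast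
        then have "u \<in> carrier G" and "g \<otimes> u \<otimes> inv g = v"
          using v g by (auto simp: group_word_simps)
        moreover from this have "u \<notin> Z" using v g conjugate_in_Z_iff[of u g] by simp
        ultimately show "u \<in> {u \<in> ?U. ?R u g}"
          using v(1) g unfolding conjugate_union_def by blast
      qed
    qed
    from bij_betw_same_card[OF this] show ?thesis using card_M_Z by simp
  qed
  \<comment> \<open>For fixed \<open>u\<close>, the admissible \<open>g\<close> form a right coset
    of \<open>M\<close>.\<close>
  have fibre_u: "card {g \<in> carrier G. ?R u g} = card M" if u: "u \<in> ?U" for u
  proof -
    obtain g where g: "u \<in> carrier G" "u \<notin> Z" "g \<in> carrier G" "g \<otimes> u \<otimes> inv g \<in> M"
      using u unfolding conjugate_union_def by blast
    have "card M = card (M #> g)"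
      using card_rcosets_equal[OF rcosetsI[OF m(3) g(3)] m(3)] .
    then show ?thesis using transporter_eq_coset[OF M g] by simp
  qed
  have "(\<Sum>u\<in>?U. card {g \<in> carrier G. ?R u g}) = (card M - card Z) * card (carrier G)"
    using fibre_g by (intro sum_multicount[OF finU fin]) blast
  moreover have "(\<Sum>u\<in>?U. card {g \<in> carrier G. ?R u g}) = card ?U * card M"
    using fibre_u by simp
  ultimately show ?thesis by (simp add: mult.commute)
qed

text \<open>A common element lies outside \<open>Z\<close> in a conjugate of \<open>M\<close> and a
  conjugate of \<open>M'\<close>, so these coincide. Then \<open>M'\<close> is conjugate to
  \<open>M\<close>, which puts \<open>w\<close> into \<open>conjugate_union M\<close>.\<close>

lemma conjugate_unions_disjoint:
  assumes M: "maximal_subgroup M G" "maximal_subgroup M' G"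
    and w: "w \<in> M'" "w \<notin> Z" "w \<notin> conjugate_union M"
  shows "conjugate_union M \<inter> conjugate_union M' = {}"
proof (rule ccontr)
  assume "conjugate_union M \<inter> conjugate_union M' \<noteq> {}"
  then obtain u g g' where u: "u \<in> carrier G" "u \<notin> Z" and g: "g \<in> carrier G" "g' \<in> carrier G"
    and "g \<otimes> u \<otimes> inv g \<in> M" "g' \<otimes> u \<otimes> inv g' \<in> M'"
    unfolding conjugate_union_def by blast
  then have "u \<in> conjugate_subset G M g \<inter> conjugate_subset G M' g'"
    unfolding conjugate_subset_def by blast
  then have eq: "conjugate_subset G M g = conjugate_subset G M' g'"
    using maximal_inter_subset_Z maximal_subgroup_conjugate_subset M g u(2) by blast
  have wG: "w \<in> carrier G" using w(1) maximalD(3)[OF M(2)] by blast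
  have "g' \<otimes> (inv g' \<otimes> w \<otimes> g') \<otimes> inv g' = w" using wG g by (simp add: group_word_simps)
  then have "inv g' \<otimes> w \<otimes> g' \<in> conjugate_subset G M' g'"
    using w(1) wG g unfolding conjugate_subset_def by simp
  then have "g \<otimes> (inv g' \<otimes> w \<otimes> g') \<otimes> inv g \<in> M"
    using eq unfolding conjugate_subset_def by blast
  moreover have "g \<otimes> (inv g' \<otimes> w \<otimes> g') \<otimes> inv g = (g \<otimes> inv g') \<otimes> w \<otimes> inv (g \<otimes> inv g')"
    using wG g by (simp add: group_word_simps)
  ultimately have "w \<in> conjugate_union M"
    using wG w(2) g unfolding conjugate_union_def by auto
  then show False using w(3) by blast
qed

text \<open>As a proper subgroup of \<open>M\<close>, \<open>Z\<close> has at most half its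
  elements, so the factor \<open>card M - card Z\<close> in the count is at least half of
  \<open>card M\<close>.\<close>

lemma card_conjugate_union_ge:
  assumes M: "maximal_subgroup M G"
  shows "card (carrier G) \<le> 2 * card (conjugate_union M)"
proof -
  note m = maximalD[OF M]
  obtain v where v: "v \<in> M" "v \<notin> Z" using maximal_not_subset_Z[OF M] by blast
  have vG: "v \<in> carrier G" using v m(3) by blast
  \<comment> \<open>The coset of \<open>Z\<close> through \<open>v\<close> is a copy of
    \<open>Z\<close> inside \<open>M - Z\<close>.\<close>
  have "(\<lambda>z. v \<otimes> z) ` Z \<subseteq> M - Z"
  proof
    fix y assume "y \<in> (\<lambda>z. v \<otimes> z) ` Z"
    then obtain z where z: "z \<in> Z" "y = v \<otimes> z" by blast
    have "y \<notin> Z"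
    proof
      assume "y \<in> Z"
      then have "y \<otimes> inv z \<in> Z" using z by simp
      then show False using z v vG Z.mem_carrier by (simp add: m_assoc)
    qed
    then show "y \<in> M - Z"
      using z v Z_subset_maximal[OF M] subgroup.m_closed[OF m(1)] by blast
  qed
  moreover have "inj_on (\<lambda>z. v \<otimes> z) Z"
    using vG Z.mem_carrier by (intro inj_onI) simp
  ultimately have "card Z \<le> card (M - Z)"
    using m(4) by (intro card_inj_on_le[of "\<lambda>z. v \<otimes> z"]) simp_all
  also have "card (M - Z) = card M - card Z"
    using card_Diff_subset[OF finite_subset[OF Z_subset_maximal[OF M] m(4)] Z_subset_maximal[OF M]] .
  finally have "card M \<le> 2 * (card M - card Z)" by linarith
  then have "card (carrier G) * card M \<le> card (carrier G) * (2 * (card M - card Z))"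
    by (rule mult_left_mono) simp
  also have "\<dots> = 2 * card (conjugate_union M) * card M"
    using card_conjugate_union[OF M] by simp
  finally show ?thesis using v(1) m(4) by (auto simp: card_gt_0_iff)
qed

text \<open>Two disjoint unions of conjugates each have at least half as many elements as
  \<open>G\<close>, but both avoid the nonempty set \<open>Z\<close>.\<close>

lemma no_minimal_counterexample: False
proof -
  obtain M where M: "maximal_subgroup M G"
    using obtains_maximal_subgroup[OF fin Z.subgroup_axioms Z_proper] by blast
  note m = maximalD[OF M]
  have U: "conjugate_union L \<subseteq> carrier G - Z" for L
    unfolding conjugate_union_def by blast
  have finU: "finite (carrier G - Z)" using fin by simp
  have finZ: "finite Z" using fin Z.subset finite_subset by blast
  have card_G_Z: "card (carrier G - Z) = card (carrier G) - card Z" "card Z \<le> card (carrier G)"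
    using card_Diff_subset[OF finZ Z.subset] card_mono[OF fin Z.subset] by auto
  have "card Z > 0" using finZ Z.one_closed card_gt_0_iff by blast
  \<comment> \<open>If the conjugates of \<open>M\<close> covered \<open>G - Z\<close>, the count
    would reduce to \<open>card M = card (carrier G)\<close>.\<close>
  have "conjugate_union M \<noteq> carrier G - Z"
  proof
    assume "conjugate_union M = carrier G - Z"
    then have eq: "(card (carrier G) - card Z) * card M = card (carrier G) * (card M - card Z)"
      using card_conjugate_union[OF M] card_G_Z(1) by simp
    have "card Z \<le> card M" using card_mono[OF m(4) Z_subset_maximal[OF M]] .
    \<comment> \<open>Passing to integers removes truncated subtraction before expanding.\<close>
    then have "(int (card (carrier G)) - int (card Z)) * int (card M)
        = int (card (carrier G)) * (int (card M) - int (card Z))"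
      using eq card_G_Z(2) by (metis of_nat_diff of_nat_mult)
    then have "int (card Z) * int (card M) = int (card Z) * int (card (carrier G))"
      by (auto simp add: algebra_simps)
    then have "card M = card (carrier G)" using \<open>card Z > 0\<close> by simp
    then show False using card_subset_eq[OF fin m(3)] m(2) by simp
  qed
  then obtain w where w: "w \<in> carrier G" "w \<notin> Z" "w \<notin> conjugate_union M" using U by blast
  note C = subgroup_centralizer_modulo_Z[OF w(1,2)]
  \<comment> \<open>The centralizer of \<open>w\<close> modulo \<open>Z\<close> is proper and
    contains \<open>w\<close>, so some maximal subgroup contains \<open>w\<close>.\<close>
  obtain M' where M': "maximal_subgroup M' G" "w \<in> M'"
    using obtains_maximal_subgroup[OF fin C(1,2)] C(3) by blast
  have "card (conjugate_union M) + card (conjugate_union M')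
      = card (conjugate_union M \<union> conjugate_union M')"
    using conjugate_unions_disjoint[OF M M' w(2,3)] finite_subset[OF U finU]
    by (simp add: card_Un_disjoint)
  also have "\<dots> \<le> card (carrier G - Z)"
    using U by (intro card_mono[OF finU]) blast
  finally have "card (conjugate_union M) + card (conjugate_union M') \<le> card (carrier G - Z)" .
  then show False
    using card_conjugate_union_ge[OF M] card_conjugate_union_ge[OF M'(1)] card_G_Z
      \<open>card Z > 0\<close> by linarith
qed

end

text \<open>Induction on the order. Proper subgroups inherit symmetry, since Engel commutators do
  not depend on the ambient group; if the hypercentre were proper, \<open>G\<close> would be a
  minimal counterexample.\<close>

lemma nilpotent_if_engel_symmetric:
  assumes "group G" "finite (carrier G)" "engel_symmetric G"
  shows "nilpotent_group G"
  using assms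
proof (induction "card (carrier G)" arbitrary: G rule: less_induct)
  case less
  interpret group G by fact
  obtain n where n: "central_modulo G (upper_central_series G n) = upper_central_series G n"
    using upper_central_series_stable[OF less.prems(2)] .
  have "nilpotent_group (G\<lparr>carrier := H\<rparr>)" if H: "subgroup H G" "H \<noteq> carrier G" for H
  proof (rule less.hyps)
    have sub: "H \<subseteq> carrier G" using subgroup.subset[OF H(1)] .
    show "card (carrier (G\<lparr>carrier := H\<rparr>)) < card (carrier G)"
      using sub H(2) less.prems(2) by (simp add: psubset_card_mono psubset_eq)
    show "group (G\<lparr>carrier := H\<rparr>)" using subgroup_imp_group[OF H(1)] .
    show "finite (carrier (G\<lparr>carrier := H\<rparr>))"
      using sub less.prems(2) finite_subset by auto
    show "engel_symmetric (G\<lparr>carrier := H\<rparr>)"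
      using less.prems(3) sub engel_commutator_consistent(1)[OF H(1)]
      by (auto simp: engel_symmetric_def subset_iff)
  qed
  note proper_nilpotent = this
  have "upper_central_series G n = carrier G"
  proof (rule ccontr)
    assume "upper_central_series G n \<noteq> carrier G"
    then interpret engel_symmetric_minimal G n "upper_central_series G n"
      using less.prems(2,3) proper_nilpotent n by unfold_locales blast+
    show False by (rule no_minimal_counterexample)
  qed
  then show ?case by (rule nilpotent_if_upper_central_series)
qed

section \<open>Engel graphs\<close>

context group
begin

lemma strong_engel_graph_eq_engel_graph_iff:
  "strong_engel_graph G = engel_graph G \<longleftrightarrow> engel_symmetric G"
proof -
  have ex: "(\<exists>k\<ge>1. engel_commutator G y k x = \<one>) \<longleftrightarrow> (\<exists>k. engel_commutator G y k x = \<one>)"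
    if "x \<in> carrier G" "y \<in> carrier G" for x y
  proof
    assume "\<exists>k. engel_commutator G y k x = \<one>"
    then obtain k where "engel_commutator G y k x = \<one>" by blast
    then have "engel_commutator G y (Suc k) x = \<one>" using that by simp
    then show "\<exists>k\<ge>1. engel_commutator G y k x = \<one>" by (intro exI[of _ "Suc k"]) simp
  qed blast
  let ?A = "parcs (engel_digraph G)"
  let ?E = "\<lambda>x y. \<exists>k. engel_commutator G y k x = \<one>"
  have arc: "(x, y) \<in> ?A \<longleftrightarrow> x \<noteq> y \<and> ?E x y"
    if "x \<in> carrier G" "y \<in> carrier G" for x y
    using that ex by (auto simp: engel_digraph_def)
  have "strong_engel_graph G = engel_graph G \<longleftrightarrow>
    (\<forall>x\<in>carrier G. \<forall>y\<in>carrier G. x \<noteq> y \<longrightarrow>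
      ((x, y) \<in> ?A \<and> (y, x) \<in> ?A \<longleftrightarrow> (x, y) \<in> ?A \<or> (y, x) \<in> ?A))"
    unfolding strong_engel_graph_def engel_graph_def by (auto simp: set_eq_iff)
  also have "\<dots> \<longleftrightarrow>
    (\<forall>x\<in>carrier G. \<forall>y\<in>carrier G. x \<noteq> y \<longrightarrow> (?E x y \<and> ?E y x \<longleftrightarrow> ?E x y \<or> ?E y x))"
    using arc by simp
  also have "\<dots> \<longleftrightarrow> engel_symmetric G"
    unfolding engel_symmetric_def by metis
  finally show ?thesis .
qed

lemma engel_symmetric_if_nilpotent:
  assumes "nilpotent_group G" shows "engel_symmetric G"
  using nilpotent_imp_engel[OF assms] unfolding engel_symmetric_def by metis

lemma nilpotent_subgroup_generated_by2_imp_arc: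
  assumes x: "x \<in> carrier G" and y: "y \<in> carrier G" and "x \<noteq> y"
    and nil: "nilpotent_group (subgroup_generated_by2 G x y)"
  shows "(x, y) \<in> parcs (engel_digraph G)"
proof -
  have sub: "subgroup (generate G {x, y}) G" using x y by (intro generate_is_subgroup) simp
  interpret H: group "subgroup_generated_by2 G x y" using subgroup_imp_group[OF sub] .
  have "x \<in> generate G {x, y}" "y \<in> generate G {x, y}" by (auto intro: generate.incl)
  moreover obtain c where "\<And>x' y'. x' \<in> generate G {x, y} \<Longrightarrow> y' \<in> generate G {x, y} \<Longrightarrow>
      engel_commutator (subgroup_generated_by2 G x y) x' (Suc c) y' = \<one>"
    using H.nilpotent_imp_engel[OF nil] by auto
  ultimately have "engel_commutator G y (Suc c) x = \<one>"
    using engel_commutator_consistent(1)[OF sub] by metis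
  then have "\<exists>k\<ge>1. engel_commutator G y k x = \<one>" by (intro exI[of _ "Suc c"]) simp
  then show ?thesis using assms by (simp add: engel_digraph_def)
qed

text \<open>Adjacency in the nilpotency graph always gives arcs both ways, because the generating
  pair is unordered. Tameness is the converse inclusion.\<close>

lemma strong_engel_graph_eq_nilpotency_graph_iff:
  "strong_engel_graph G = nilpotency_graph G \<longleftrightarrow> two_sided_engel_tame G"
proof -
  let ?A = "parcs (engel_digraph G)" and ?N = "\<lambda>x y. nilpotent_group (subgroup_generated_by2 G x y)"
  have A: "x \<in> carrier G \<and> y \<in> carrier G \<and> x \<noteq> y" if "(x, y) \<in> ?A" for x y
    using that by (auto simp: engel_digraph_def)
  have N: "(x, y) \<in> ?A \<and> (y, x) \<in> ?A"
    if "x \<in> carrier G" "y \<in> carrier G" "x \<noteq> y" "?N x y" for x y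
    using that nilpotent_subgroup_generated_by2_imp_arc[of x y]
      nilpotent_subgroup_generated_by2_imp_arc[of y x] by (simp add: insert_commute)
  have "strong_engel_graph G = nilpotency_graph G \<longleftrightarrow>
    (\<forall>x\<in>carrier G. \<forall>y\<in>carrier G. x \<noteq> y \<longrightarrow> ((x, y) \<in> ?A \<and> (y, x) \<in> ?A \<longleftrightarrow> ?N x y))"
    unfolding strong_engel_graph_def nilpotency_graph_def by (auto simp: set_eq_iff)
  also have "\<dots> \<longleftrightarrow> two_sided_engel_tame G"
    unfolding two_sided_engel_tame_def using A N by blast
  finally show ?thesis .
qed

end

theorem mainTheorem6:
  fixes G :: "('a, 'b) monoid_scheme"
  assumes "group G" and "finite (carrier G)"
  shows "(strong_engel_graph G = engel_graph G \<longleftrightarrow> nilpotent_group G) \<and>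
         (strong_engel_graph G = nilpotency_graph G \<longleftrightarrow> two_sided_engel_tame G)"
proof -
  interpret group G by fact
  show ?thesis
    using strong_engel_graph_eq_engel_graph_iff strong_engel_graph_eq_nilpotency_graph_iff
      engel_symmetric_if_nilpotent nilpotent_if_engel_symmetric[OF assms] by blast
qed

end
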